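(* Let $P_0\in\mathcal{P}(\mathbb{R}^d)$ be smooth, and let both the location halfspace median set $\mathfrak{M}^{\mathrm{loc}}(P_0)$ and the scatter halfspace median set $\mathfrak{M}^{\mathrm{sc}}(P_0)$ contain single elements. Denote the location median of $P_0$ by $T(P_0)\in\mathbb{R}^d$ and the scatter halfspace median matrix of $P_0$ (the unique element of $\mathfrak{M}^{\mathrm{sc}}(P_0)$) by $\boldsymbol\Sigma^{\mathrm{hs}}\in\mathbb{PD}_d$. Then: (i) For any sequence of distributions $\{P_n\}_{n=1}^\infty\subset\mathcal{P}(\mathbb{R}^d)$ converging weakly to $P_0$ and any sequence $\boldsymbol\Sigma_n\in\mathfrak{M}^{\mathrm{sc}}(P_n)$ we have $\lim_{n\to\infty}\boldsymbol\Sigma_n=\boldsymbol\Sigma^{\mathrm{hs}}$. (ii) Let $\widehat P_n\in\mathcal{P}(\mathbb{R}^d)$ be the empirical distribution of a random sample $\boldsymbol X_1,\dots,\boldsymbol X_n$ from $P_0$. Then the sample scatter halfspace median matrix is strongly consistent, meaning that for any $\widehat{\boldsymbol\Sigma}_n\in\mathfrak{M}^{\mathrm{sc}}(\widehat P_n)$ we have $\lim_{n\to\infty}\widehat{\boldsymbol\Sigma}_n=\boldsymbol\Sigma^{\mathrm{hs}}$ almost surely.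
   Context: $\mathcal{P}(\mathbb{R}^d)$ is the set of Borel probability distributions on $\mathbb{R}^d$, $\mathbb{S}^{d-1}$ the Euclidean unit sphere, $\mathbb{PD}_d$ the set of positive definite (symmetric) $d\times d$ real matrices; convergence of matrices is element-wise. $P$ is smooth if $P(\{\boldsymbol x\in\mathbb{R}^d:\langle\boldsymbol x,\boldsymbol u\rangle=t\})=0$ for all $\boldsymbol u\in\mathbb{S}^{d-1}$, $t\in\mathbb{R}$. Halfspace depth: $\mathcal{D}(\boldsymbol x;P)=\inf_{\boldsymbol u\in\mathbb{S}^{d-1}}\mathbb{P}(\langle\boldsymbol X,\boldsymbol u\rangle\le\langle\boldsymbol x,\boldsymbol u\rangle)$, $\boldsymbol X\sim P$. The location halfspace median set is $\mathfrak{M}^{\mathrm{loc}}(P)=\{\boldsymbol x\in\mathbb{R}^d:\mathcal{D}(\boldsymbol x;P)=\max_{\boldsymbol y\in\mathbb{R}^d}\mathcal{D}(\boldsymbol y;P)\}$ (always non-empty, compact, convex), and $T(P)$ denotes its barycenter (the expectation of a random vector uniformly distributed on it). Scatter halfspace depth of $\boldsymbol\Sigma\in\mathbb{PD}_d$: $$\mathcal{SD}(\boldsymbol\Sigma;P)=\inf_{\boldsymbol u\in\mathbb{S}^{d-1}}\min\left\{\mathbb{P}\left(|\langle\boldsymbol X-T(P),\boldsymbol u\rangle|\le\sqrt{\boldsymbol u^{\mathsf T}\boldsymbol\Sigma\boldsymbol u}\right),\ \mathbb{P}\left(|\langle\boldsymbol X-T(P),\boldsymbol u\rangle|\ge\sqrt{\boldsymbol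 u^{\mathsf T}\boldsymbol\Sigma\boldsymbol u}\right)\right\},\quad\boldsymbol X\sim P.$$ The scatter halfspace median set is $\mathfrak{M}^{\mathrm{sc}}(P)=\{\boldsymbol\Sigma\in\mathbb{PD}_d:\mathcal{SD}(\boldsymbol\Sigma;P)=\sup_{\mathbf{S}\in\mathbb{PD}_d}\mathcal{SD}(\mathbf{S};P)\}$. The empirical distribution $\widehat P_n$ assigns mass $1/n$ to each $\boldsymbol X_i$. *)

theory Defs
  imports "HOL-Probability.Probability"
begin

definition borel_distributions :: "'a::euclidean_space measure set" where
  "borel_distributions = {P. prob_space P \<and> sets P = sets borel}"

definition smooth_dist :: "'a::euclidean_space measure \<Rightarrow> bool" where
  "smooth_dist P \<longleftrightarrow> (\<forall>u\<in>sphere 0 1. \<forall>t. measure P {x. x \<bullet> u = t} = 0)"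

(* The weak_conv_m of HOL-Probability covers only distributions on the real line. *)
definition weakly_converges ::
  "(nat \<Rightarrow> 'a::euclidean_space measure) \<Rightarrow> 'a measure \<Rightarrow> bool" where
  "weakly_converges P P0 \<longleftrightarrow>
     (\<forall>f::'a \<Rightarrow> real. continuous_on UNIV f \<longrightarrow> bounded (range f) \<longrightarrow>
        (\<lambda>n. \<integral>x. f x \<partial>P n) \<longlonglongrightarrow> (\<integral>x. f x \<partial>P0))"

definition halfspace_depth :: "'a::euclidean_space \<Rightarrow> 'a measure \<Rightarrow> real" where
  "halfspace_depth x P = (INF u\<in>sphere 0 1. measure P {y. y \<bullet> u \<le> x \<bullet> u})"

definition loc_median_set :: "'a::euclidean_space measure \<Rightarrow> 'a set" where
  "loc_median_set P = {x. \<forall>y. halfspace_depth y P \<le> halfspace_depth x P}"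

(* For an orthonormal set B this is Lebesgue measure of dimension card B on the affine
   subspace p + span B, in the same form in which the library defines lborel
   (p = 0, B = Basis). *)
definition affine_lborel :: "'a::euclidean_space \<Rightarrow> 'a set \<Rightarrow> 'a measure" where
  "affine_lborel p B =
     distr (\<Pi>\<^sub>M b\<in>B. lborel) borel (\<lambda>f. p + (\<Sum>b\<in>B. f b *\<^sub>R b))"

definition orthonormal_basis_of :: "'a::euclidean_space set \<Rightarrow> 'a set \<Rightarrow> bool" where
  "orthonormal_basis_of V B \<longleftrightarrow>
     pairwise orthogonal B \<and> (\<forall>b\<in>B. norm b = 1) \<and> span B = V"

(* Uniform distribution on a non-empty compact convex set K. A median set may have dimension
   smaller than that of the ambient space, and then it is a null set of lborel; the reference
   measure is therefore Lebesgue measure on the affine hull of K. As Lebesgue measure is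
   invariant under isometries, the choice of the base point p and of the orthonormal basis B
   does not matter. *)
definition uniform_on :: "'a::euclidean_space set \<Rightarrow> 'a measure" where
  "uniform_on K =
     (let p = (SOME p. p \<in> K);
          B = (SOME B. orthonormal_basis_of (span ((\<lambda>x. x - p) ` K)) B)
      in uniform_measure (affine_lborel p B) K)"

definition barycenter :: "'a::euclidean_space set \<Rightarrow> 'a" where
  "barycenter K = (\<integral>x. x \<partial>uniform_on K)"

definition loc_median :: "'a::euclidean_space measure \<Rightarrow> 'a" where
  "loc_median P = barycenter (loc_median_set P)"

definition PD :: "(real^'d^'d) set" where
  "PD = {S. transpose S = S \<and> (\<forall>x. x \<noteq> 0 \<longrightarrow> 0 < x \<bullet> (S *v x))}"

definition scatter_depth :: "real^'d^'d \<Rightarrow> (real^'d) measure \<Rightarrow> real" where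
  "scatter_depth S P =
     (INF u\<in>sphere 0 1.
        min (measure P {x. \<bar>(x - loc_median P) \<bullet> u\<bar> \<le> sqrt (u \<bullet> (S *v u))})
            (measure P {x. \<bar>(x - loc_median P) \<bullet> u\<bar> \<ge> sqrt (u \<bullet> (S *v u))}))"

definition scatter_median_set :: "(real^'d) measure \<Rightarrow> (real^'d^'d) set" where
  "scatter_median_set P =
     {S\<in>PD. scatter_depth S P = (SUP S'\<in>PD. scatter_depth S' P)}"

(* The push-forward keeps multiplicities: a point that occurs k times among
   x 1, ..., x n has mass k/n. *)
definition empirical :: "nat \<Rightarrow> (nat \<Rightarrow> 'a::euclidean_space) \<Rightarrow> 'a measure" where
  "empirical n x = distr (uniform_count_measure {1..n}) borel x"

definition random_sample ::
  "'w measure \<Rightarrow> 'a::euclidean_space measure \<Rightarrow> (nat \<Rightarrow> 'w \<Rightarrow> 'a) \<Rightarrow> bool" where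
  "random_sample M P X \<longleftrightarrow>
     prob_space M \<and> prob_space.indep_vars M (\<lambda>_. borel) X {1..} \<and>
     (\<forall>i\<ge>1. distr M borel (X i) = P)"

lemma orthonormal_basis_of_exists:
  fixes V :: "'a::euclidean_space set"
  assumes "subspace V"
  shows "\<exists>B. orthonormal_basis_of V B"
  using orthonormal_basis_subspace[OF assms] unfolding orthonormal_basis_of_def by metis

lemma barycenter_singleton: "barycenter {a} = (a::'a::euclidean_space)"
proof -
  define B where "B = (SOME B. orthonormal_basis_of (span ((\<lambda>x. x - a) ` {a})) B)"
  have "orthonormal_basis_of (span ((\<lambda>x. x - a) ` {a})) B"
    unfolding B_def by (rule someI_ex, rule orthonormal_basis_of_exists) simp
  then have n: "\<forall>b\<in>B. norm b = 1" and s: "span B = {0}"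
    by (auto simp: orthonormal_basis_of_def)
  have "b = 0" if "b \<in> B" for b
    using span_base[OF that] s by simp
  with n have B: "B = {}"
    by (metis equals0I norm_zero zero_neq_one)
  interpret R: prob_space "\<Pi>\<^sub>M b\<in>({}::'a set). (lborel :: real measure)"
    by (rule prob_spaceI) (simp add: PiM_empty)
  have A: "affine_lborel a {} = return borel a"
    unfolding affine_lborel_def by (simp add: R.distr_const)
  have "uniform_measure (return borel a) {a} = return borel a"
  proof (rule measure_eqI)
    fix A assume "A \<in> sets (uniform_measure (return borel a) {a})"
    then show "emeasure (uniform_measure (return borel a) {a}) A = emeasure (return borel a) A"
      by (simp add: emeasure_return indicator_def)
  qed simp
  then have "uniform_on {a} = return borel a"
    using A B unfolding uniform_on_def B_def by (simp add: Let_def)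
  then show ?thesis
    unfolding barycenter_def by (simp add: integral_return)
qed

end

theory Submission
  imports Defs
begin

text \<open>
  Both parts reduce to one deterministic statement (\<open>scatter_median_tendsto\<close>) about
  distributions \<open>P n\<close> that converge to \<open>P0\<close> uniformly over all closed halfspaces.

  Halfspaces are parametrised by the compact unit sphere of \<open>(u, t)\<close>-space. As \<open>P0\<close> does not
  charge hyperplanes, compactness makes thin slabs around hyperplanes uniformly small
  (\<open>smooth_thin_slabs\<close>). This has two consequences. The halfspace probabilities of \<open>P0\<close> are
  uniformly continuous (\<open>hs_prob_uniformly_continuous\<close>), and halfspace indicators can be
  bracketed by finitely many continuous functions (\<open>halfspace_bracketing_exists\<close>), so that the
  integrals of countably many bounded continuous functions decide uniform convergence over
  halfspaces (\<open>hs_convergence_determining\<close>). For a weakly convergent sequence these integrals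
  converge by definition; for empirical distributions they converge almost surely by the strong
  law of large numbers (\<open>random_sample_strong_law\<close>).

  Under uniform convergence over halfspaces the location depth converges uniformly. Its unique
  maximiser for \<open>P0\<close> is well separated, so the location median sets of \<open>P n\<close>, and with them
  their barycenters, converge to the median of \<open>P0\<close> (\<open>loc_median_tendsto\<close>). Slab probabilities
  are combinations of halfspace probabilities; hence the scatter depth, with its moving centre,
  converges uniformly over all positive definite matrices
  (\<open>scatter_depth_uniformly_close\<close>), and scatter medians of \<open>P n\<close> nearly maximise the scatter
  depth of \<open>P0\<close>. The latter is continuous, and matrices whose depth exceeds a positive level
  have spectrum in a fixed compact subinterval of the positive axis
  (\<open>scatter_depth_region_spectral_box\<close>): a small eigenvalue would put that much mass on a thin
  slab, a large one would put it far away from the centre. So the unique scatter median of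
  \<open>P0\<close> is well separated as well.
\<close>

section \<open>Infima and well-separated maximisers\<close>

lemma abs_INF_diff_le:
  fixes f g :: "'b \<Rightarrow> real"
  assumes "A \<noteq> {}" "bdd_below (f ` A)" "bdd_below (g ` A)"
    and "\<And>x. x \<in> A \<Longrightarrow> \<bar>f x - g x\<bar> \<le> e"
  shows "\<bar>(INF x\<in>A. f x) - (INF x\<in>A. g x)\<bar> \<le> e"
proof -
  have *: "(INF x\<in>A. h x) - e \<le> (INF x\<in>A. k x)"
    if "bdd_below (h ` A)" "\<And>x. x \<in> A \<Longrightarrow> \<bar>h x - k x\<bar> \<le> e" for h k :: "'b \<Rightarrow> real"
  proof (rule cINF_greatest[OF assms(1)])
    fix x assume "x \<in> A"
    then show "(INF x\<in>A. h x) - e \<le> k x"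
      using cINF_lower[OF that(1) \<open>x \<in> A\<close>] that(2)[OF \<open>x \<in> A\<close>] by linarith
  qed
  have "(INF x\<in>A. f x) - e \<le> (INF x\<in>A. g x)"
    by (rule *) (use assms in auto)
  moreover have "(INF x\<in>A. g x) - e \<le> (INF x\<in>A. f x)"
    by (rule *) (use assms in \<open>auto simp: abs_minus_commute\<close>)
  ultimately show ?thesis by linarith
qed

text \<open>
  If \<open>f\<close> is at least \<open>c < f a\<close> only inside a compact set on which \<open>a\<close> is the unique maximiser,
  then near-maximisers are close to \<open>a\<close>.
\<close>
lemma unique_maximiser_well_separated:
  fixes f :: "'b::metric_space \<Rightarrow> real"
  assumes K: "compact K" and cont: "continuous_on K f"
    and sup: "\<And>y. y \<in> S \<Longrightarrow> c \<le> f y \<Longrightarrow> y \<in> K" and c: "c < f a"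
    and max: "\<And>y. y \<in> K \<Longrightarrow> y \<noteq> a \<Longrightarrow> f y < f a"
    and e: "0 < e"
  shows "\<exists>\<eta>>0. \<forall>y\<in>S. f a - \<eta> \<le> f y \<longrightarrow> dist y a < e"
proof -
  let ?K = "K \<inter> {y. e \<le> dist y a}"
  have "closed {y. e \<le> dist y a}"
    by (intro closed_Collect_le continuous_intros)
  then have cpt: "compact ?K"
    by (rule compact_Int_closed[OF K])
  obtain m where m: "m < f a" "\<And>y. y \<in> ?K \<Longrightarrow> f y \<le> m"
  proof (cases "?K = {}")
    case True
    then show ?thesis using that c by fastforce
  next
    case False
    obtain z where "z \<in> ?K" "\<forall>y\<in>?K. f y \<le> f z"
      using continuous_attains_sup[OF cpt False continuous_on_subset[OF cont]] by auto
    then show ?thesis using that max[of z] e by force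
  qed
  let ?\<eta> = "(f a - max c m) / 2"
  have "dist y a < e" if "y \<in> S" "f a - ?\<eta> \<le> f y" for y
  proof (rule ccontr)
    have *: "c < f y" "m < f y"
      using that(2) c m(1) by (auto simp: max_def field_simps split: if_splits)
    assume "\<not> dist y a < e"
    then have "y \<in> ?K"
      using sup[OF that(1)] * by auto
    then show False using m(2) * by force
  qed
  moreover have "?\<eta> > 0" using c m by auto
  ultimately show ?thesis by blast
qed

section \<open>Halfspaces under a smooth distribution\<close>

lemma borel_distributionsD:
  assumes "P \<in> borel_distributions"
  shows "prob_space P" "sets P = sets borel" "space P = UNIV"
  using assms sets_eq_imp_space_eq[of P borel] by (auto simp: borel_distributions_def)

text \<open>
  The distribution function of the projection to direction \<open>u\<close>, evaluated at \<open>t\<close>; for unit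
  vectors \<open>u\<close> this is the mass of a closed halfspace.
\<close>
definition hs_prob :: "'a::euclidean_space measure \<Rightarrow> 'a \<Rightarrow> real \<Rightarrow> real" where
  "hs_prob P u t = measure P {x. x \<bullet> u \<le> t}"

text \<open>
  The hyperplane with normal \<open>u\<close> and offset \<open>t\<close> is described by the pair \<open>w = (u, t)\<close>.
  Dividing the affine form by the norm of \<open>(x, 1)\<close> makes it Lipschitz in \<open>w\<close> with constant
  1 uniformly in \<open>x\<close>; up to scaling, halfspaces (together with the empty set and the whole
  space, which are the cases \<open>u = 0\<close>) are then parametrised by a compact unit sphere, and no
  separate tightness argument is needed.
\<close>
definition hs_form :: "'a::euclidean_space \<times> real \<Rightarrow> 'a \<Rightarrow> real" where
  "hs_form w x = ((x, -1) \<bullet> w) / norm (x, 1::real)"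

lemma norm_Pair_one_ge: "1 \<le> norm (x::'a::euclidean_space, 1::real)"
  using norm_snd_le[of "1::real" x] by simp

lemma Pair_one_neq_0 [simp]: "(x::'a::euclidean_space, 1::real) \<noteq> 0"
  by (simp add: zero_prod_def)

lemma norm_Pair_one_pos: "0 < norm (x::'a::euclidean_space, 1::real)"
  using norm_Pair_one_ge[of x] by linarith

lemma hs_form_Pair: "hs_form (u, t) x = (x \<bullet> u - t) / norm (x, 1::real)"
  by (simp add: hs_form_def inner_prod_def)

lemma hs_form_scaleR: "hs_form (c *\<^sub>R w) x = c * hs_form w x"
  by (simp add: hs_form_def)

lemma hs_form_le_0_iff: "hs_form (u, t) x \<le> 0 \<longleftrightarrow> x \<bullet> u \<le> t"
  by (auto simp: hs_form_Pair divide_le_0_iff)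

lemma abs_hs_form_le: "\<bar>hs_form (u, t) x\<bar> \<le> \<bar>x \<bullet> u - t\<bar>"
proof -
  have "\<bar>x \<bullet> u - t\<bar> * 1 \<le> \<bar>x \<bullet> u - t\<bar> * norm (x, 1::real)"
    by (intro mult_left_mono norm_Pair_one_ge) auto
  then show ?thesis
    by (simp add: hs_form_Pair pos_divide_le_eq norm_Pair_one_pos)
qed

lemma hs_form_lipschitz: "\<bar>hs_form w x - hs_form w' x\<bar> \<le> norm (w - w')"
proof -
  have "\<bar>(x, -1) \<bullet> (w - w')\<bar> \<le> norm (x, -1::real) * norm (w - w')"
    by (rule Cauchy_Schwarz_ineq2)
  also have "norm (x, -1::real) = norm (x, 1::real)"
    by (simp add: norm_prod_def)
  finally show ?thesis
    by (simp add: hs_form_def inner_diff_right pos_divide_le_eq norm_Pair_one_pos mult.commute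
        flip: diff_divide_distrib)
qed

lemma continuous_on_hs_form [continuous_intros]: "continuous_on A (hs_form w)"
proof -
  have "norm (x, 1::real) \<noteq> 0" for x :: 'a
    using norm_Pair_one_pos[of x] by linarith
  then show ?thesis
    unfolding hs_form_def by (intro continuous_intros) auto
qed

lemma borel_measurable_hs_form [measurable]: "hs_form w \<in> borel_measurable borel"
  by (rule borel_measurable_continuous_onI) (rule continuous_on_hs_form)

lemma smooth_null_hs_form:
  assumes P: "P \<in> borel_distributions" "smooth_dist P" and w: "norm w = 1"
  shows "measure P {x. hs_form w x = 0} = 0"
proof (cases "fst w = 0")
  case True
  then have "{x. hs_form w x = 0} = {}"
    using w by (cases w) (auto simp: hs_form_def)
  then show ?thesis by simp
next
  case False
  obtain u t where ut: "w = (u, t)" by force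
  with False have "hs_form w x = 0 \<longleftrightarrow> x \<bullet> (u /\<^sub>R norm u) = t / norm u" for x
    by (auto simp: hs_form_Pair field_simps)
  then have "{x. hs_form w x = 0} = {x. x \<bullet> (u /\<^sub>R norm u) = t / norm u}"
    by blast
  moreover have "u /\<^sub>R norm u \<in> sphere 0 1"
    using False ut by simp
  then have "measure P {x. x \<bullet> (u /\<^sub>R norm u) = t / norm u} = 0"
    using P(2) unfolding smooth_dist_def by blast
  ultimately show ?thesis by (simp only:)
qed

text \<open>The slabs \<open>{\<bar>hs_form w\<bar> \<le> \<delta>}\<close> around all hyperplanes are uniformly thin.\<close>
lemma smooth_thin_slabs:
  assumes P: "P \<in> borel_distributions" "smooth_dist P" and e: "0 < e"
  shows "\<exists>\<delta>>0. \<forall>w. 1 \<le> norm w \<longrightarrow> measure P {x. \<bar>hs_form w x\<bar> \<le> \<delta>} \<le> e"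
proof -
  interpret prob_space P using borel_distributionsD[OF P(1)] by simp
  note [measurable_cong] = borel_distributionsD(2)[OF P(1)]
  note space [simp] = borel_distributionsD(3)[OF P(1)]
  have slab [measurable]: "{x. \<bar>hs_form w x\<bar> \<le> d} \<in> sets P" for w d
  proof -
    have "{x \<in> space P. \<bar>hs_form w x\<bar> \<le> d} \<in> sets P" by measurable
    then show ?thesis by simp
  qed
  have pt: "\<exists>d>0. measure P {x. \<bar>hs_form w x\<bar> \<le> 2 * d} < e" if w: "norm w = 1" for w
  proof -
    let ?A = "\<lambda>n. {x. \<bar>hs_form w x\<bar> \<le> inverse (real (Suc n))}"
    have "decseq ?A"
    proof (rule decseq_SucI, safe)
      fix n x assume *: "\<bar>hs_form w x\<bar> \<le> inverse (real (Suc (Suc n)))"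
      also have "\<dots> \<le> inverse (real (Suc n))" by (simp add: field_simps)
      finally show "\<bar>hs_form w x\<bar> \<le> inverse (real (Suc n))" .
    qed
    then have "(\<lambda>n. measure P (?A n)) \<longlonglongrightarrow> measure P (\<Inter>n. ?A n)"
      by (intro finite_Lim_measure_decseq) auto
    also have "(\<Inter>n. ?A n) = {x. hs_form w x = 0}"
    proof safe
      fix x assume x: "x \<in> (\<Inter>n. ?A n)"
      show "hs_form w x = 0"
      proof (rule ccontr)
        assume "hs_form w x \<noteq> 0"
        then obtain n where "inverse (real (Suc n)) < \<bar>hs_form w x\<bar>"
          using reals_Archimedean[of "\<bar>hs_form w x\<bar>"] by auto
        then show False using x by (auto simp: not_le dest!: spec[of _ n])
      qed
    qed auto
    finally have "(\<lambda>n. measure P (?A n)) \<longlonglongrightarrow> 0"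
      using smooth_null_hs_form[OF P w] by simp
    then have "eventually (\<lambda>n. measure P (?A n) < e) sequentially"
      by (rule order_tendstoD) (rule e)
    then obtain n where "measure P (?A n) < e"
      by (auto simp: eventually_sequentially)
    then show ?thesis
      by (intro exI[of _ "inverse (real (Suc n)) / 2"]) auto
  qed
  \<comment> \<open>Finitely many of these pointwise widths suffice, as the parameter sphere is compact.\<close>
  then obtain d where d: "\<And>w. norm w = 1 \<Longrightarrow> 0 < d w"
    "\<And>w. norm w = 1 \<Longrightarrow> measure P {x. \<bar>hs_form w x\<bar> \<le> 2 * d w} < e"
    by metis
  let ?S = "sphere (0::'a \<times> real) 1"
  have "\<exists>C. C \<subseteq> ?S \<and> finite C \<and> ?S \<subseteq> (\<Union>w\<in>C. ball w (d w))"
  proof (rule compactE_image[of ?S ?S "\<lambda>w. ball w (d w)"])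
    show "?S \<subseteq> (\<Union>w\<in>?S. ball w (d w))" using d(1) by force
  qed auto
  then obtain C where C: "C \<subseteq> ?S" "finite C" "?S \<subseteq> (\<Union>w\<in>C. ball w (d w))" by blast
  have "?S \<noteq> {}" by simp
  with C have Cne: "C \<noteq> {}" by blast
  let ?\<delta> = "Min (d ` C)"
  have pos: "?\<delta> > 0" using C Cne d(1) by auto
  have unit: "measure P {x. \<bar>hs_form w x\<bar> \<le> ?\<delta>} \<le> e" if w1: "norm w = 1" for w
  proof -
    obtain v where v: "v \<in> C" "norm (v - w) < d v"
    proof -
      have "w \<in> ?S" using w1 by simp
      with C(3) have "w \<in> (\<Union>v\<in>C. ball v (d v))" by (rule subsetD)
      then obtain v where "v \<in> C" "w \<in> ball v (d v)" by (rule UN_E)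
      then show ?thesis by (intro that[of v]) (simp_all add: dist_norm)
    qed
    have "?\<delta> \<le> d v" using C v by simp
    then have "{x. \<bar>hs_form w x\<bar> \<le> ?\<delta>} \<subseteq> {x. \<bar>hs_form v x\<bar> \<le> 2 * d v}"
    proof safe
      fix x assume "?\<delta> \<le> d v" "\<bar>hs_form w x\<bar> \<le> ?\<delta>"
      with v(2) hs_form_lipschitz[of v x w] show "\<bar>hs_form v x\<bar> \<le> 2 * d v" by linarith
    qed
    then have "measure P {x. \<bar>hs_form w x\<bar> \<le> ?\<delta>} \<le> measure P {x. \<bar>hs_form v x\<bar> \<le> 2 * d v}"
      by (rule finite_measure_mono) (rule slab)
    also have "v \<in> ?S" using C(1) v(1) by (rule subsetD)
    then have "measure P {x. \<bar>hs_form v x\<bar> \<le> 2 * d v} < e" by (intro d(2)) simp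
    finally show ?thesis by simp
  qed
  have "measure P {x. \<bar>hs_form w x\<bar> \<le> ?\<delta>} \<le> e" if w: "1 \<le> norm w" for w
  proof -
    let ?w = "w /\<^sub>R norm w"
    have "norm ?w = 1" using w by (cases "w = 0") auto
    have "{x. \<bar>hs_form w x\<bar> \<le> ?\<delta>} \<subseteq> {x. \<bar>hs_form ?w x\<bar> \<le> ?\<delta>}"
    proof safe
      fix x assume "\<bar>hs_form w x\<bar> \<le> ?\<delta>"
      moreover have "inverse (norm w) * \<bar>hs_form w x\<bar> \<le> 1 * \<bar>hs_form w x\<bar>"
        using w by (intro mult_right_mono) (auto simp: inverse_le_1_iff)
      ultimately show "\<bar>hs_form ?w x\<bar> \<le> ?\<delta>"
        by (simp add: hs_form_scaleR abs_mult)
    qed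
    then have "measure P {x. \<bar>hs_form w x\<bar> \<le> ?\<delta>} \<le> measure P {x. \<bar>hs_form ?w x\<bar> \<le> ?\<delta>}"
      by (rule finite_measure_mono) (rule slab)
    with unit[OF \<open>norm ?w = 1\<close>] show ?thesis by linarith
  qed
  with pos show ?thesis by blast
qed

lemma hs_prob_uniformly_continuous:
  assumes P: "P \<in> borel_distributions" "smooth_dist P" and e: "0 < e"
  shows "\<exists>\<delta>>0. \<forall>u\<in>sphere 0 1. \<forall>s t. \<bar>s - t\<bar> \<le> \<delta> \<longrightarrow> \<bar>hs_prob P u s - hs_prob P u t\<bar> \<le> e"
proof -
  interpret prob_space P using borel_distributionsD[OF P(1)] by simp
  note [measurable_cong] = borel_distributionsD(2)[OF P(1)]
  note space [simp] = borel_distributionsD(3)[OF P(1)]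
  obtain \<delta> where \<delta>: "\<delta> > 0"
    "\<And>w. 1 \<le> norm w \<Longrightarrow> measure P {x. \<bar>hs_form w x\<bar> \<le> \<delta>} \<le> e"
    using smooth_thin_slabs[OF P e] by blast
  have *: "hs_prob P u s \<le> hs_prob P u t \<and> hs_prob P u t \<le> hs_prob P u s + e"
    if u: "norm u = 1" and st: "s \<le> t" "t \<le> s + \<delta>" for u s t
  proof
    have hs [measurable]: "{x. x \<bullet> u \<le> t} \<in> sets P" for t
    proof -
      have "{x \<in> space P. x \<bullet> u \<le> t} \<in> sets P" by measurable
      then show ?thesis by simp
    qed
    have sl [measurable]: "{x. \<bar>hs_form (u, s) x\<bar> \<le> \<delta>} \<in> sets P"
    proof -
      have "{x \<in> space P. \<bar>hs_form (u, s) x\<bar> \<le> \<delta>} \<in> sets P" by measurable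
      then show ?thesis by simp
    qed
    show "hs_prob P u s \<le> hs_prob P u t"
      unfolding hs_prob_def using st by (intro finite_measure_mono) auto
    have "{x. x \<bullet> u \<le> t} \<subseteq> {x. x \<bullet> u \<le> s} \<union> {x. \<bar>hs_form (u, s) x\<bar> \<le> \<delta>}"
    proof safe
      fix x assume "x \<bullet> u \<le> t" "\<not> \<bar>hs_form (u, s) x\<bar> \<le> \<delta>"
      with abs_hs_form_le[of u s x] st show "x \<bullet> u \<le> s" by linarith
    qed
    then have "hs_prob P u t \<le> measure P ({x. x \<bullet> u \<le> s} \<union> {x. \<bar>hs_form (u, s) x\<bar> \<le> \<delta>})"
      unfolding hs_prob_def by (rule finite_measure_mono) measurable
    also have "\<dots> \<le> hs_prob P u s + measure P {x. \<bar>hs_form (u, s) x\<bar> \<le> \<delta>}"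
      unfolding hs_prob_def by (rule measure_Un_le) measurable
    also have "measure P {x. \<bar>hs_form (u, s) x\<bar> \<le> \<delta>} \<le> e"
      using \<delta>(2)[of "(u, s)"] norm_fst_le[of u s] u by simp
    finally show "hs_prob P u t \<le> hs_prob P u s + e" by simp
  qed
  have "\<bar>hs_prob P u s - hs_prob P u t\<bar> \<le> e"
    if u: "u \<in> sphere 0 1" and st: "\<bar>s - t\<bar> \<le> \<delta>" for u s t
    using *[of u s t] *[of u t s] u st by (cases "s \<le> t") auto
  with \<delta>(1) show ?thesis by blast
qed

section \<open>Uniform convergence over halfspaces\<close>

text \<open>Convergence in the halfspace metric \<open>sup\<^sub>H \<bar>P\<^sub>n H - P\<^sub>0 H\<bar>\<close>.\<close>
definition hs_converges ::
  "(nat \<Rightarrow> 'a::euclidean_space measure) \<Rightarrow> 'a measure \<Rightarrow> bool" where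
  "hs_converges P P0 \<longleftrightarrow> (\<forall>e>0. eventually
     (\<lambda>n. \<forall>u\<in>sphere 0 1. \<forall>t. \<bar>hs_prob (P n) u t - hs_prob P0 u t\<bar> \<le> e) sequentially)"

lemma hs_convergesD:
  "hs_converges P P0 \<Longrightarrow> 0 < e \<Longrightarrow> eventually
     (\<lambda>n. \<forall>u\<in>sphere 0 1. \<forall>t. \<bar>hs_prob (P n) u t - hs_prob P0 u t\<bar> \<le> e) sequentially"
  unfolding hs_converges_def by blast

text \<open>Truncation to the unit interval.\<close>
definition ramp :: "real \<Rightarrow> real" where
  "ramp s = max 0 (min 1 s)"

lemma ramp_bounds: "0 \<le> ramp s" "ramp s \<le> 1"
  by (auto simp: ramp_def)

lemma continuous_on_ramp_hs_form:
  "continuous_on UNIV (\<lambda>x. ramp (a + b * hs_form w x))"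
  unfolding ramp_def by (intro continuous_intros)

text \<open>
  A finite family of continuous functions that encloses every halfspace indicator between two
  of its members whose integrals differ by at most \<open>e\<close>.
\<close>
definition halfspace_bracketing ::
  "'a::euclidean_space measure \<Rightarrow> real \<Rightarrow> ('a \<Rightarrow> real) set \<Rightarrow> bool" where
  "halfspace_bracketing P e F \<longleftrightarrow>
     finite F \<and> (\<forall>f\<in>F. continuous_on UNIV f \<and> range f \<subseteq> {0..1}) \<and>
     (\<forall>u\<in>sphere 0 1. \<forall>t. \<exists>f\<in>F. \<exists>g\<in>F.
        (\<forall>x. f x \<le> indicator {x. x \<bullet> u \<le> t} x \<and> indicator {x. x \<bullet> u \<le> t} x \<le> g x) \<and>
        (\<integral>x. g x \<partial>P) \<le> (\<integral>x. f x \<partial>P) + e)"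

text \<open>
  A net of the compact parameter sphere whose mesh is half the width of the thin slabs gives
  a bracketing, since parameters within that mesh move \<open>hs_form\<close> by at most half the width.
\<close>
lemma halfspace_bracketing_exists:
  fixes P :: "'a::euclidean_space measure"
  assumes P: "P \<in> borel_distributions" "smooth_dist P" and e: "0 < e"
  shows "\<exists>F. halfspace_bracketing P e F"
proof -
  interpret prob_space P using borel_distributionsD[OF P(1)] by simp
  note [measurable_cong] = borel_distributionsD(2)[OF P(1)]
  note space [simp] = borel_distributionsD(3)[OF P(1)]
  obtain \<delta> where \<delta>: "\<delta> > 0"
    "\<And>w. 1 \<le> norm w \<Longrightarrow> measure P {x. \<bar>hs_form w x\<bar> \<le> \<delta>} \<le> e"
    using smooth_thin_slabs[OF P e] by blast
  let ?S = "sphere (0::'a \<times> real) 1"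
  have "\<exists>C. C \<subseteq> ?S \<and> finite C \<and> ?S \<subseteq> (\<Union>w\<in>C. ball w (\<delta> / 2))"
  proof (rule compactE_image[of ?S ?S "\<lambda>w. ball w (\<delta> / 2)"])
    show "?S \<subseteq> (\<Union>w\<in>?S. ball w (\<delta> / 2))" using \<delta>(1) by force
  qed auto
  then obtain C where C: "C \<subseteq> ?S" "finite C" "?S \<subseteq> (\<Union>w\<in>C. ball w (\<delta> / 2))" by blast
  \<comment> \<open>\<open>lo w\<close> falls from 1 to 0 between \<open>hs_form w = -\<delta>\<close> and \<open>-\<delta>/2\<close>, and \<open>up w\<close>
    between \<open>\<delta>/2\<close> and \<open>\<delta>\<close>.\<close>
  define lo where "lo w x = ramp (- 1 + (- 2 / \<delta>) * hs_form w x)" for w :: "'a \<times> real" and x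
  define up where "up w x = ramp (2 + (- 2 / \<delta>) * hs_form w x)" for w :: "'a \<times> real" and x
  have cont: "continuous_on UNIV (lo w)" "continuous_on UNIV (up w)" for w
    unfolding lo_def up_def by (rule continuous_on_ramp_hs_form)+
  have rng: "range (lo w) \<subseteq> {0..1}" "range (up w) \<subseteq> {0..1}" for w
    by (auto simp: lo_def up_def ramp_bounds)
  have int: "integrable P (lo w)" "integrable P (up w)" for w
    using rng[of w]
    by (auto intro!: integrable_const_bound[of _ 1] borel_measurable_continuous_onI[OF cont(1)]
        borel_measurable_continuous_onI[OF cont(2)] simp: image_subset_iff
        measurable_cong_sets[OF borel_distributionsD(2)[OF P(1)] refl])
  have lo0: "lo w x = 0" if "- \<delta> / 2 \<le> hs_form w x" for w x
    using that \<delta>(1) by (simp add: lo_def ramp_def field_simps)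
  have up1: "up w x = 1" if "hs_form w x \<le> \<delta> / 2" for w x
    using that \<delta>(1) by (simp add: up_def ramp_def field_simps min_def max_def)
  have up0: "up w x = 0" if "\<delta> \<le> hs_form w x" for w x
    using that \<delta>(1) by (simp add: up_def ramp_def field_simps min_def max_def)
  have lo1: "lo w x = 1" if "hs_form w x \<le> - \<delta>" for w x
    using that \<delta>(1) by (simp add: lo_def ramp_def field_simps min_def max_def)
  have gap: "(\<integral>x. up w x \<partial>P) \<le> (\<integral>x. lo w x \<partial>P) + e" if w: "w \<in> ?S" for w
  proof -
    let ?I = "indicator {x. \<bar>hs_form w x\<bar> \<le> \<delta>} :: 'a \<Rightarrow> real"
    have "{x \<in> space P. \<bar>hs_form w x\<bar> \<le> \<delta>} \<in> sets P" by measurable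
    then have A: "{x. \<bar>hs_form w x\<bar> \<le> \<delta>} \<in> sets P" by simp
    have intI: "integrable P ?I"
      using A by (simp add: emeasure_eq_measure)
    have "up w x \<le> lo w x + ?I x" for x
    proof (cases "\<bar>hs_form w x\<bar> \<le> \<delta>")
      case True
      then show ?thesis by (simp add: lo_def up_def) (smt (verit) ramp_bounds)
    next
      case False
      then have "\<delta> \<le> hs_form w x \<or> hs_form w x \<le> - \<delta>" by linarith
      then show ?thesis
        using rng[of w] \<delta>(1) by (auto simp: up0 lo1 image_subset_iff intro: add_increasing2)
    qed
    then have "(\<integral>x. up w x \<partial>P) \<le> (\<integral>x. lo w x + ?I x \<partial>P)"
      using int intI by (intro integral_mono) auto
    also have "\<dots> = (\<integral>x. lo w x \<partial>P) + measure P {x. \<bar>hs_form w x\<bar> \<le> \<delta>}"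
      using int intI A by simp
    also have "measure P {x. \<bar>hs_form w x\<bar> \<le> \<delta>} \<le> e" using \<delta>(2) w by auto
    finally show ?thesis by simp
  qed
  have br: "\<exists>f\<in>lo ` C \<union> up ` C. \<exists>g\<in>lo ` C \<union> up ` C.
       (\<forall>x. f x \<le> indicator {x. x \<bullet> u \<le> t} x \<and> indicator {x. x \<bullet> u \<le> t} x \<le> g x) \<and>
       (\<integral>x. g x \<partial>P) \<le> (\<integral>x. f x \<partial>P) + e" if u: "u \<in> sphere 0 1" for u :: 'a and t
  proof -
    have pos: "0 < norm (u, t)" using u by (auto simp: zero_prod_def)
    define v where "v = (u, t) /\<^sub>R norm (u, t)"
    have "v \<in> ?S" using pos by (simp add: v_def del: scaleR_Pair)
    with C(3) have "v \<in> (\<Union>w\<in>C. ball w (\<delta> / 2))" by (rule subsetD)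
    then obtain w where w: "w \<in> C" "v \<in> ball w (\<delta> / 2)" by (rule UN_E)
    then have w': "norm (w - v) < \<delta> / 2" by (simp add: dist_norm)
    have H: "x \<bullet> u \<le> t \<longleftrightarrow> hs_form v x \<le> 0" for x
      using pos by (simp add: v_def hs_form_scaleR mult_le_0_iff inverse_eq_divide divide_le_0_iff
          flip: hs_form_le_0_iff del: scaleR_Pair)
    have "lo w x \<le> indicator {x. x \<bullet> u \<le> t} x \<and> indicator {x. x \<bullet> u \<le> t} x \<le> up w x" for x
    proof (cases "hs_form v x \<le> 0")
      case True
      then have "hs_form w x \<le> \<delta> / 2"
        using hs_form_lipschitz[of w x v] w' by linarith
      then show ?thesis
        using True rng[of w] by (auto simp: H up1 image_subset_iff)
    next
      case False
      then have "- \<delta> / 2 \<le> hs_form w x"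
        using hs_form_lipschitz[of w x v] w' by linarith
      then show ?thesis
        using False rng[of w] by (auto simp: H lo0 image_subset_iff)
    qed
    moreover have "w \<in> ?S" using C(1) w(1) by blast
    ultimately show ?thesis using w(1) gap by blast
  qed
  have "continuous_on UNIV f \<and> range f \<subseteq> {0..1}" if "f \<in> lo ` C \<union> up ` C" for f
    using that by (elim UnE imageE; simp only: cont rng simp_thms)
  then have "halfspace_bracketing P e (lo ` C \<union> up ` C)"
    unfolding halfspace_bracketing_def
    by (intro conjI ballI allI br) (use C(2) in simp_all)
  then show ?thesis ..
qed

lemma hs_prob_close_of_bracketing:
  assumes P: "P \<in> borel_distributions" and Q: "Q \<in> borel_distributions"
    and F: "halfspace_bracketing P e F"
    and close: "\<And>f. f \<in> F \<Longrightarrow> \<bar>(\<integral>x. f x \<partial>Q) - (\<integral>x. f x \<partial>P)\<bar> \<le> e"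
    and u: "u \<in> sphere 0 1"
  shows "\<bar>hs_prob Q u t - hs_prob P u t\<bar> \<le> 2 * e"
proof -
  from F u obtain f g where fg: "f \<in> F" "g \<in> F"
    and br: "\<And>x. f x \<le> indicator {x. x \<bullet> u \<le> t} x" "\<And>x. indicator {x. x \<bullet> u \<le> t} x \<le> g x"
    and gap: "(\<integral>x. g x \<partial>P) \<le> (\<integral>x. f x \<partial>P) + e"
    unfolding halfspace_bracketing_def by meson
  have *: "(\<integral>x. f x \<partial>R) \<le> hs_prob R u t \<and> hs_prob R u t \<le> (\<integral>x. g x \<partial>R)"
    if R: "R \<in> borel_distributions" for R
  proof -
    interpret R: prob_space R using borel_distributionsD[OF R] by simp
    note [measurable_cong] = borel_distributionsD(2)[OF R]
    have "{x \<in> space R. x \<bullet> u \<le> t} \<in> sets R" by measurable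
    then have A: "{x. x \<bullet> u \<le> t} \<in> sets R" using borel_distributionsD(3)[OF R] by simp
    have int: "integrable R h" if "h \<in> F" for h
      using F that unfolding halfspace_bracketing_def
      by (intro R.integrable_const_bound[of _ 1])
        (auto intro!: borel_measurable_continuous_onI simp: image_subset_iff
          measurable_cong_sets[OF borel_distributionsD(2)[OF R] refl])
    have intI: "integrable R (indicator {x. x \<bullet> u \<le> t} :: _ \<Rightarrow> real)"
      using A by (simp add: R.emeasure_eq_measure)
    have "(\<integral>x. f x \<partial>R) \<le> (\<integral>x. indicator {x. x \<bullet> u \<le> t} x \<partial>R)"
      by (intro integral_mono int fg intI br)
    moreover have "(\<integral>x. indicator {x. x \<bullet> u \<le> t} x \<partial>R) \<le> (\<integral>x. g x \<partial>R)"
      by (intro integral_mono int fg intI br)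
    ultimately show ?thesis using A by (simp add: hs_prob_def)
  qed
  from *[OF P] *[OF Q] close[OF fg(1)] close[OF fg(2)] gap show ?thesis
    by linarith
qed

text \<open>Countably many test functions decide convergence over halfspaces to a smooth limit.\<close>
lemma hs_convergence_determining:
  fixes P0 :: "'a::euclidean_space measure"
  assumes P0: "P0 \<in> borel_distributions" "smooth_dist P0"
  shows "\<exists>\<F>. countable \<F> \<and> (\<forall>f\<in>\<F>. continuous_on UNIV f \<and> range f \<subseteq> {0..1::real}) \<and>
    (\<forall>P. eventually (\<lambda>n. P n \<in> borel_distributions) sequentially \<longrightarrow>
       (\<forall>f\<in>\<F>. (\<lambda>n. \<integral>x. f x \<partial>P n) \<longlonglongrightarrow> (\<integral>x. f x \<partial>P0)) \<longrightarrow> hs_converges P P0)"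
proof -
  have "\<forall>k. \<exists>F. halfspace_bracketing P0 (inverse (real (Suc k))) F"
    by (intro allI halfspace_bracketing_exists[OF P0]) simp
  from choice[OF this] obtain F
    where br: "\<And>k. halfspace_bracketing P0 (inverse (real (Suc k))) (F k)" by blast
  then have fin: "finite (F k)"
    and F: "f \<in> F k \<Longrightarrow> continuous_on UNIV f \<and> range f \<subseteq> {0..1::real}" for k f
    unfolding halfspace_bracketing_def by blast+
  have "hs_converges P P0"
    if P: "eventually (\<lambda>n. P n \<in> borel_distributions) sequentially"
      and lim: "\<And>k f. f \<in> F k \<Longrightarrow> (\<lambda>n. \<integral>x. f x \<partial>P n) \<longlonglongrightarrow> (\<integral>x. f x \<partial>P0)" for P
    unfolding hs_converges_def
  proof (intro allI impI)
    fix e :: real assume "0 < e"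
    then obtain k where k: "inverse (real (Suc k)) < e / 2"
      using reals_Archimedean[of "e / 2"] by auto
    let ?e = "inverse (real (Suc k))"
    have "eventually (\<lambda>n. \<bar>(\<integral>x. f x \<partial>P n) - (\<integral>x. f x \<partial>P0)\<bar> \<le> ?e) sequentially"
      if "f \<in> F k" for f
    proof -
      have "eventually (\<lambda>n. dist (\<integral>x. f x \<partial>P n) (\<integral>x. f x \<partial>P0) < ?e) sequentially"
        by (rule tendstoD[OF lim[OF that]]) simp
      then show ?thesis
        by eventually_elim (simp add: dist_real_def)
    qed
    then have "eventually (\<lambda>n. \<forall>f\<in>F k. \<bar>(\<integral>x. f x \<partial>P n) - (\<integral>x. f x \<partial>P0)\<bar> \<le> ?e) sequentially"
      using fin by (simp add: eventually_ball_finite_distrib)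
    with P show "eventually (\<lambda>n. \<forall>u\<in>sphere 0 1. \<forall>t.
        \<bar>hs_prob (P n) u t - hs_prob P0 u t\<bar> \<le> e) sequentially"
    proof eventually_elim
      case (elim n)
      show ?case
      proof (intro ballI allI)
        fix u :: 'a and t :: real assume u: "u \<in> sphere 0 1"
        have "\<bar>hs_prob (P n) u t - hs_prob P0 u t\<bar> \<le> 2 * ?e"
          by (rule hs_prob_close_of_bracketing[OF P0(1) elim(1) br _ u]) (use elim(2) in blast)
        with k show "\<bar>hs_prob (P n) u t - hs_prob P0 u t\<bar> \<le> e" by linarith
      qed
    qed
  qed
  then have "\<forall>P. eventually (\<lambda>n. P n \<in> borel_distributions) sequentially \<longrightarrow>
      (\<forall>f\<in>\<Union>k. F k. (\<lambda>n. \<integral>x. f x \<partial>P n) \<longlonglongrightarrow> (\<integral>x. f x \<partial>P0)) \<longrightarrow> hs_converges P P0"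
    by (intro allI impI) blast
  moreover have "countable (\<Union>k. F k)"
    using fin by (intro countable_UN countable_finite countableI_type)
  moreover have "\<forall>f\<in>\<Union>k. F k. continuous_on UNIV f \<and> range f \<subseteq> {0..1::real}"
    using F by (intro ballI) (elim UN_E)
  ultimately show ?thesis by (intro exI conjI)
qed

lemma weakly_converges_imp_hs_converges:
  assumes P0: "P0 \<in> borel_distributions" "smooth_dist P0"
    and P: "\<And>n. P n \<in> borel_distributions" and w: "weakly_converges P P0"
  shows "hs_converges P P0"
proof -
  obtain \<F> where \<F>: "\<And>f. f \<in> \<F> \<Longrightarrow> continuous_on UNIV f \<and> range f \<subseteq> {0..1::real}"
    and det: "\<And>P. eventually (\<lambda>n. P n \<in> borel_distributions) sequentially \<Longrightarrow>
       (\<forall>f\<in>\<F>. (\<lambda>n. \<integral>x. f x \<partial>P n) \<longlonglongrightarrow> (\<integral>x. f x \<partial>P0)) \<Longrightarrow> hs_converges P P0"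
    using hs_convergence_determining[OF P0] by metis
  have "(\<lambda>n. \<integral>x. f x \<partial>P n) \<longlonglongrightarrow> (\<integral>x. f x \<partial>P0)" if "f \<in> \<F>" for f
  proof -
    have "bounded (range f)"
      using \<F>[OF that] bounded_subset[OF bounded_closed_interval] by blast
    with w \<F>[OF that] show ?thesis by (simp add: weakly_converges_def)
  qed
  with P show ?thesis by (intro det) auto
qed

section \<open>The location median\<close>

text \<open>
  In the coordinates given by \<open>B\<close>, the set \<open>K\<close> lies in a bounded box, and it contains a
  non-degenerate box because its relative interior is non-empty. The uniform distribution on
  \<open>K\<close> is thus a probability measure.
\<close>
lemma affine_lborel_bounds:
  fixes K :: "'a::euclidean_space set"
  assumes K: "compact K" "convex K" "p \<in> K"
    and B: "orthonormal_basis_of (span ((\<lambda>x. x - p) ` K)) B"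
  shows "emeasure (affine_lborel p B) K \<noteq> 0" "emeasure (affine_lborel p B) K \<noteq> \<infinity>"
proof -
  interpret product_sigma_finite "\<lambda>_::'a. lborel :: real measure" ..
  have orth: "pairwise orthogonal B" and nrm: "\<And>b. b \<in> B \<Longrightarrow> norm b = 1"
    and spn: "span B = span ((\<lambda>x. x - p) ` K)"
    using B by (auto simp: orthonormal_basis_of_def)
  have fin: "finite B" by (rule pairwise_orthogonal_imp_finite[OF orth])
  let ?M = "\<Pi>\<^sub>M b\<in>B. (lborel :: real measure)"
  let ?\<phi> = "\<lambda>f. p + (\<Sum>b\<in>B. f b *\<^sub>R b)"
  let ?V = "?\<phi> -` K \<inter> space ?M"
  have meas: "?\<phi> \<in> borel_measurable ?M" by measurable
  have Kb: "K \<in> sets borel" using K(1) by (simp add: borel_compact)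
  have V: "?V \<in> sets ?M" using meas Kb by (rule measurable_sets)
  have em: "emeasure (affine_lborel p B) K = emeasure ?M ?V"
    unfolding affine_lborel_def by (rule emeasure_distr[OF meas Kb])
  have coord: "(\<Sum>b\<in>B. f b *\<^sub>R b) \<bullet> c = f c" if "c \<in> B" for f c
  proof -
    have "(\<Sum>b\<in>B. f b *\<^sub>R b) \<bullet> c = (\<Sum>b\<in>B. if b = c then f c else 0)"
      unfolding inner_sum_left
    proof (rule sum.cong[OF refl])
      fix b assume "b \<in> B"
      show "(f b *\<^sub>R b) \<bullet> c = (if b = c then f c else 0)"
        using orth nrm[OF that] \<open>b \<in> B\<close> that
        by (auto simp: pairwise_def orthogonal_def dot_square_norm)
    qed
    then show ?thesis using fin that by simp
  qed
  obtain R where R: "\<And>x. x \<in> K \<Longrightarrow> norm (x - p) \<le> R"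
    using compact_imp_bounded[OF K(1)] unfolding bounded_any_center[of _ p]
    by (auto simp: dist_norm norm_minus_commute)
  have "?V \<subseteq> (\<Pi>\<^sub>E b\<in>B. {-R..R})"
  proof
    fix f assume f: "f \<in> ?V"
    have "f b \<in> {-R..R}" if b: "b \<in> B" for b
    proof -
      have "\<bar>f b\<bar> = \<bar>(?\<phi> f - p) \<bullet> b\<bar>" using coord[OF b] by simp
      also have "\<dots> \<le> norm (?\<phi> f - p) * norm b" by (rule Cauchy_Schwarz_ineq2)
      also have "\<dots> \<le> R" using R[of "?\<phi> f"] f nrm[OF b] by simp
      finally show ?thesis by auto
    qed
    with f show "f \<in> (\<Pi>\<^sub>E b\<in>B. {-R..R})"
      by (auto simp: space_PiM PiE_iff)
  qed
  then have "emeasure ?M ?V \<le> emeasure ?M (\<Pi>\<^sub>E b\<in>B. {-R..R})"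
    by (rule emeasure_mono) (auto intro!: sets_PiM_I_finite fin)
  also have "\<dots> = (\<Prod>b\<in>B. emeasure lborel {-R..R})"
    using fin by (intro emeasure_PiM) auto
  also have "\<dots> < \<infinity>"
    by (simp add: emeasure_lborel_Icc_eq power_less_top_ennreal power_0_left)
  finally show "emeasure (affine_lborel p B) K \<noteq> \<infinity>" by (simp add: em)
  have "rel_interior K \<noteq> {}"
    using rel_interior_eq_empty[OF K(2)] K(3) by auto
  then obtain q e where q: "q \<in> K" and e: "e > 0" "cball q e \<inter> affine hull K \<subseteq> K"
    by (auto simp: mem_rel_interior_cball)
  define r where "r = e / (real (card B) + 1)"
  have r: "r > 0" "real (card B) * r \<le> e"
    using e by (auto simp: r_def field_simps)
  let ?A = "\<lambda>b. {(q - p) \<bullet> b - r .. (q - p) \<bullet> b + r}"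
  have "(\<lambda>x. x - p) ` K = insert 0 ((\<lambda>x. x - p) ` (K - {p}))" using K(3) by force
  then have aff: "affine hull K = {p + v | v. v \<in> span B}"
    unfolding spn using affine_hull_span2[OF K(3)] by auto
  have qB: "(\<Sum>b\<in>B. ((q - p) \<bullet> b) *\<^sub>R b) = q - p"
  proof (rule orthonormal_basis_expand[OF orth nrm _ fin])
    show "q - p \<in> span B" unfolding spn using q by (intro span_base) auto
  qed
  have "(\<Pi>\<^sub>E b\<in>B. ?A b) \<subseteq> ?V"
  proof
    fix f assume f: "f \<in> (\<Pi>\<^sub>E b\<in>B. ?A b)"
    have "?\<phi> f - q = (\<Sum>b\<in>B. (f b - (q - p) \<bullet> b) *\<^sub>R b)"
      using qB by (simp add: scaleR_left_diff_distrib sum_subtractf)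
    also have "norm \<dots> \<le> (\<Sum>b\<in>B. r)"
    proof (rule sum_norm_le)
      fix b assume b: "b \<in> B"
      then have "f b \<in> ?A b" using f by auto
      then show "norm ((f b - (q - p) \<bullet> b) *\<^sub>R b) \<le> r"
        using nrm[OF b] by (simp add: abs_le_iff)
    qed
    also have "\<dots> \<le> e" using r by simp
    finally have "?\<phi> f \<in> cball q e" by (simp add: dist_norm norm_minus_commute)
    moreover have "?\<phi> f \<in> affine hull K"
      unfolding aff by (rule CollectI, rule exI, rule conjI[OF refl], intro span_sum span_scale span_base)
    ultimately have "?\<phi> f \<in> K" using e by blast
    with f show "f \<in> ?V" by (auto simp: space_PiM PiE_iff)
  qed
  then have "emeasure ?M (\<Pi>\<^sub>E b\<in>B. ?A b) \<le> emeasure ?M ?V"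
    using V by (rule emeasure_mono)
  moreover have "emeasure ?M (\<Pi>\<^sub>E b\<in>B. ?A b) = (\<Prod>b\<in>B. emeasure lborel (?A b))"
    using fin by (intro emeasure_PiM) auto
  moreover have "\<dots> \<noteq> 0"
    using r fin by (auto simp: prod_zero_iff)
  ultimately show "emeasure (affine_lborel p B) K \<noteq> 0" unfolding em by auto
qed

lemma barycenter_in_cball:
  fixes K :: "'a::euclidean_space set"
  assumes K: "compact K" "convex K" "K \<noteq> {}" and sub: "K \<subseteq> cball a r"
  shows "barycenter K \<in> cball a r"
proof -
  define p where "p = (SOME p. p \<in> K)"
  define B where "B = (SOME B. orthonormal_basis_of (span ((\<lambda>x. x - p) ` K)) B)"
  have p: "p \<in> K" using K(3) unfolding p_def by (auto intro: someI)
  have B: "orthonormal_basis_of (span ((\<lambda>x. x - p) ` K)) B"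
    unfolding B_def by (rule someI_ex, rule orthonormal_basis_of_exists) simp
  let ?U = "uniform_measure (affine_lborel p B) K"
  have U: "uniform_on K = ?U"
    unfolding uniform_on_def Let_def p_def[symmetric] B_def[symmetric] ..
  interpret prob_space ?U
    by (rule prob_space_uniform_measure) (use affine_lborel_bounds[OF K(1,2) p B] in auto)
  have sU: "sets (affine_lborel p B) = sets borel" by (simp add: affine_lborel_def)
  then have Kb: "K \<in> sets (affine_lborel p B)" using K(1) by (simp add: borel_compact)
  have [measurable_cong]: "sets ?U = sets borel" using sU by simp
  have AE: "AE x in ?U. norm (x - a) \<le> r"
    by (intro AE_uniform_measureI[OF Kb] AE_I2)
      (use sub in \<open>auto simp: dist_norm norm_minus_commute\<close>)
  have int: "integrable ?U (\<lambda>x. x - a)"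
    by (rule integrable_const_bound[OF AE]) measurable
  have "integrable ?U (\<lambda>x. (x - a) + a)"
    by (intro Bochner_Integration.integrable_add int) simp
  then have "(\<integral>x. x - a \<partial>?U) = barycenter K - a"
    unfolding barycenter_def U using prob_space
    by (subst Bochner_Integration.integral_diff) simp_all
  then have "norm (barycenter K - a) \<le> (\<integral>x. norm (x - a) \<partial>?U)"
    using integral_norm_bound[of ?U "\<lambda>x. x - a"] by simp
  also have "\<dots> \<le> r"
    by (rule integral_le_const[OF integrable_norm[OF int] AE])
  finally show ?thesis by (simp add: dist_norm norm_minus_commute)
qed

lemma bdd_below_hs_prob: "bdd_below ((\<lambda>u. hs_prob P u (t u)) ` A)"
  by (rule bdd_belowI[of _ 0]) (auto simp: hs_prob_def)

lemma halfspace_depth_eq: "halfspace_depth x P = (INF u\<in>sphere 0 1. hs_prob P u (x \<bullet> u))"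
  by (simp add: halfspace_depth_def hs_prob_def)

lemma halfspace_depth_le: "u \<in> sphere 0 1 \<Longrightarrow> halfspace_depth x P \<le> hs_prob P u (x \<bullet> u)"
  unfolding halfspace_depth_eq by (rule cINF_lower[OF bdd_below_hs_prob])

lemma halfspace_depth_ge_iff:
  "c \<le> halfspace_depth (x::'a::euclidean_space) P \<longleftrightarrow> (\<forall>u\<in>sphere 0 1. c \<le> hs_prob P u (x \<bullet> u))"
  unfolding halfspace_depth_eq by (rule le_cINF_iff[OF _ bdd_below_hs_prob]) simp

lemma hs_prob_mono:
  assumes "P \<in> borel_distributions" "s \<le> t"
  shows "hs_prob P u s \<le> hs_prob P u t"
proof -
  interpret prob_space P using borel_distributionsD[OF assms(1)] by simp
  note [measurable_cong] = borel_distributionsD(2)[OF assms(1)]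
  have "{x \<in> space P. x \<bullet> u \<le> t} \<in> sets P" by measurable
  then show ?thesis
    unfolding hs_prob_def using borel_distributionsD(3)[OF assms(1)] assms(2)
    by (intro finite_measure_mono) auto
qed

lemma hs_prob_right_continuous:
  assumes P: "P \<in> borel_distributions"
  shows "(\<lambda>n. hs_prob P u (t + inverse (real (Suc n)))) \<longlonglongrightarrow> hs_prob P u t"
proof -
  interpret prob_space P using borel_distributionsD[OF P] by simp
  note [measurable_cong] = borel_distributionsD(2)[OF P]
  let ?A = "\<lambda>n. {x. x \<bullet> u \<le> t + inverse (real (Suc n))}"
  have "{x \<in> space P. x \<bullet> u \<le> s} \<in> sets P" for s by measurable
  then have A: "range ?A \<subseteq> sets P" using borel_distributionsD(3)[OF P] by auto
  have "decseq ?A"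
  proof (rule decseq_SucI, safe)
    fix n x assume *: "x \<bullet> u \<le> t + inverse (real (Suc (Suc n)))"
    also have "inverse (real (Suc (Suc n))) \<le> inverse (real (Suc n))" by (simp add: field_simps)
    finally show "x \<bullet> u \<le> t + inverse (real (Suc n))" by simp
  qed
  with A have "(\<lambda>n. measure P (?A n)) \<longlonglongrightarrow> measure P (\<Inter>n. ?A n)"
    by (rule finite_Lim_measure_decseq)
  also have "(\<Inter>n. ?A n) = {x. x \<bullet> u \<le> t}"
  proof safe
    fix x assume x: "x \<in> (\<Inter>n. ?A n)"
    show "x \<bullet> u \<le> t"
    proof (rule ccontr)
      assume "\<not> x \<bullet> u \<le> t"
      then obtain n where "inverse (real (Suc n)) < x \<bullet> u - t"
        using reals_Archimedean[of "x \<bullet> u - t"] by auto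
      moreover have "x \<bullet> u \<le> t + inverse (real (Suc n))" using x by blast
      ultimately show False by linarith
    qed
  next
    fix x n assume "x \<bullet> u \<le> t"
    moreover have "0 \<le> inverse (real (Suc n))" by simp
    ultimately show "x \<bullet> u \<le> t + inverse (real (Suc n))" by linarith
  qed
  finally show ?thesis by (simp add: hs_prob_def)
qed

text \<open>The depth regions are intersections of closed halfspaces.\<close>
lemma depth_region_closed_convex:
  fixes P :: "'a::euclidean_space measure"
  assumes P: "P \<in> borel_distributions"
  shows "closed {x. c \<le> halfspace_depth x P}" "convex {x. c \<le> halfspace_depth x P}"
proof -
  have *: "closed {x. c \<le> hs_prob P u (x \<bullet> u)} \<and> convex {x. c \<le> hs_prob P u (x \<bullet> u)}" for u
  proof
    show "closed {x. c \<le> hs_prob P u (x \<bullet> u)}"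
      unfolding closed_sequential_limits
    proof (intro allI impI, elim conjE)
      fix y l assume y: "\<forall>n. y n \<in> {x. c \<le> hs_prob P u (x \<bullet> u)}" "y \<longlonglongrightarrow> l"
      have "c \<le> hs_prob P u (l \<bullet> u + inverse (real (Suc m)))" for m
      proof -
        have "(\<lambda>n. y n \<bullet> u) \<longlonglongrightarrow> l \<bullet> u"
          using y(2) by (intro tendsto_intros)
        then have "eventually (\<lambda>n. y n \<bullet> u < l \<bullet> u + inverse (real (Suc m))) sequentially"
          by (rule order_tendstoD) simp
        then obtain n where n: "y n \<bullet> u \<le> l \<bullet> u + inverse (real (Suc m))"
          by (auto simp: eventually_sequentially intro: less_imp_le)
        have "c \<le> hs_prob P u (y n \<bullet> u)" using y(1) by auto
        with hs_prob_mono[OF P n, of u] show ?thesis by linarith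
      qed
      then show "l \<in> {x. c \<le> hs_prob P u (x \<bullet> u)}"
        using LIMSEQ_le_const[OF hs_prob_right_continuous[OF P]] by auto
    qed
    show "convex {x. c \<le> hs_prob P u (x \<bullet> u)}"
    proof (rule convexI, clarify)
      fix x y and a b :: real
      assume xy: "c \<le> hs_prob P u (x \<bullet> u)" "c \<le> hs_prob P u (y \<bullet> u)"
        and ab: "0 \<le> a" "0 \<le> b" "a + b = 1"
      let ?m = "min (x \<bullet> u) (y \<bullet> u)"
      have "?m = a * ?m + b * ?m" using ab(3) by (simp flip: distrib_right)
      also have "\<dots> \<le> a * (x \<bullet> u) + b * (y \<bullet> u)"
        using ab by (intro add_mono mult_left_mono) auto
      finally have "?m \<le> (a *\<^sub>R x + b *\<^sub>R y) \<bullet> u" by (simp add: inner_add_left)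
      from hs_prob_mono[OF P this, of u] xy
      show "c \<le> hs_prob P u ((a *\<^sub>R x + b *\<^sub>R y) \<bullet> u)"
        by (auto simp: min_def split: if_splits)
    qed
  qed
  have eq: "{x. c \<le> halfspace_depth x P} = (\<Inter>u\<in>sphere 0 1. {x. c \<le> hs_prob P u (x \<bullet> u)})"
    by (auto simp: halfspace_depth_ge_iff)
  show "closed {x. c \<le> halfspace_depth x P}" "convex {x. c \<le> halfspace_depth x P}"
    unfolding eq using * by (auto intro!: closed_INT convex_INT)
qed

lemma loc_median_set_eq: "loc_median_set P = (\<Inter>y. {x. halfspace_depth y P \<le> halfspace_depth x P})"
  by (auto simp: loc_median_set_def)

lemma loc_median_set_closed_convex:
  assumes "P \<in> borel_distributions"
  shows "closed (loc_median_set P)" "convex (loc_median_set P)"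
  unfolding loc_median_set_eq
  using depth_region_closed_convex[OF assms] by (auto intro!: closed_INT convex_INT)

text \<open>A bounded non-empty depth region forces the maximal depth to be attained in it.\<close>
lemma loc_median_set_nonempty:
  fixes P :: "'a::euclidean_space measure"
  assumes P: "P \<in> borel_distributions"
    and bd: "bounded {x. halfspace_depth a P \<le> halfspace_depth x P}"
  shows "loc_median_set P \<noteq> {}"
proof -
  let ?R = "\<lambda>c. {x. c \<le> halfspace_depth x P}"
  let ?\<F> = "(\<lambda>y. ?R (max (halfspace_depth a P) (halfspace_depth y P))) ` (UNIV :: 'a set)"
  have mx: "\<exists>z. max (halfspace_depth a P) (halfspace_depth y P) = halfspace_depth z P" for y
    by (cases "halfspace_depth a P \<le> halfspace_depth y P") (auto simp: max_def)
  have "\<Inter>?\<F> \<noteq> {}"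
  proof (rule compact_chain)
    fix S assume S: "S \<in> ?\<F>"
    then obtain y where y: "S = ?R (max (halfspace_depth a P) (halfspace_depth y P))" by auto
    have "S \<subseteq> ?R (halfspace_depth a P)" unfolding y by auto
    then show "compact S"
      using bounded_subset[OF bd] depth_region_closed_convex(1)[OF P]
      unfolding compact_eq_bounded_closed y by blast
  next
    show "{} \<notin> ?\<F>"
    proof
      assume "{} \<in> ?\<F>"
      then obtain y where y: "?R (max (halfspace_depth a P) (halfspace_depth y P)) = {}" by auto
      from mx[of y] obtain z where "max (halfspace_depth a P) (halfspace_depth y P) = halfspace_depth z P" ..
      with y have "z \<notin> ?R (halfspace_depth z P)" by simp
      then show False by simp
    qed
  next
    fix S T assume "S \<in> ?\<F> \<and> T \<in> ?\<F>"
    then obtain s t where "S = ?R s" "T = ?R t" by blast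
    then show "S \<subseteq> T \<or> T \<subseteq> S" by (cases "s \<le> t") auto
  qed
  moreover have "\<Inter>?\<F> \<subseteq> loc_median_set P"
    by (auto simp: loc_median_set_def)
  ultimately show ?thesis by blast
qed

lemma halfspace_depth_close:
  fixes x y :: "'a::euclidean_space"
  assumes "\<And>u. u \<in> sphere 0 1 \<Longrightarrow> \<bar>hs_prob P u (x \<bullet> u) - hs_prob Q u (y \<bullet> u)\<bar> \<le> e"
  shows "\<bar>halfspace_depth x P - halfspace_depth y Q\<bar> \<le> e"
  unfolding halfspace_depth_eq
  by (rule abs_INF_diff_le) (use assms bdd_below_hs_prob in auto)

lemma halfspace_depth_continuous:
  fixes P :: "'a::euclidean_space measure"
  assumes P: "P \<in> borel_distributions" "smooth_dist P"
  shows "continuous_on UNIV (\<lambda>x. halfspace_depth x P)"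
  unfolding continuous_on_iff
proof (intro ballI allI impI)
  fix x :: 'a and e :: real assume e: "0 < e"
  then obtain d where d: "d > 0"
    "\<And>u s t. u \<in> sphere 0 1 \<Longrightarrow> \<bar>s - t\<bar> \<le> d \<Longrightarrow> \<bar>hs_prob P u s - hs_prob P u t\<bar> \<le> e / 2"
    using hs_prob_uniformly_continuous[OF P, of "e / 2"] by auto
  have "dist (halfspace_depth y P) (halfspace_depth x P) < e" if y: "dist y x < d" for y
  proof -
    have "\<bar>halfspace_depth y P - halfspace_depth x P\<bar> \<le> e / 2"
    proof (intro halfspace_depth_close d(2))
      fix u :: 'a assume u: "u \<in> sphere 0 1"
      have "\<bar>y \<bullet> u - x \<bullet> u\<bar> \<le> norm (y - x) * norm u"
        unfolding inner_diff_left[symmetric] by (rule Cauchy_Schwarz_ineq2)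
      then show "\<bar>y \<bullet> u - x \<bullet> u\<bar> \<le> d" using u y by (simp add: dist_norm)
    qed
    then show ?thesis using e by (simp add: dist_real_def)
  qed
  then show "\<exists>d>0. \<forall>y\<in>UNIV. dist y x < d \<longrightarrow> dist (halfspace_depth y P) (halfspace_depth x P) < e"
    using d(1) by blast
qed

lemma mass_far_away_small:
  fixes P :: "'a::euclidean_space measure"
  assumes P: "P \<in> borel_distributions" and e: "0 < e"
  shows "\<exists>r>0. measure P {x. r \<le> norm (x - a)} < e"
proof -
  interpret prob_space P using borel_distributionsD[OF P] by simp
  note [measurable_cong] = borel_distributionsD(2)[OF P]
  let ?A = "\<lambda>n. {x. real (Suc n) \<le> norm (x - a)}"
  have "{x \<in> space P. s \<le> norm (x - a)} \<in> sets P" for s by measurable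
  then have A: "range ?A \<subseteq> sets P" using borel_distributionsD(3)[OF P] by auto
  have "decseq ?A" by (rule decseq_SucI) auto
  with A have "(\<lambda>n. measure P (?A n)) \<longlonglongrightarrow> measure P (\<Inter>n. ?A n)"
    by (rule finite_Lim_measure_decseq)
  also have "(\<Inter>n. ?A n) = {}"
  proof safe
    fix x assume x: "x \<in> (\<Inter>n. ?A n)"
    obtain n where "norm (x - a) < real n" using reals_Archimedean2 by blast
    moreover have "real (Suc n) \<le> norm (x - a)" using x by blast
    ultimately show "x \<in> {}" by simp
  qed
  finally have "(\<lambda>n. measure P (?A n)) \<longlonglongrightarrow> 0" by simp
  then have "eventually (\<lambda>n. measure P (?A n) < e) sequentially"
    using e by (rule order_tendstoD)
  then obtain n where "measure P (?A n) < e"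
    by (auto simp: eventually_sequentially)
  then show ?thesis by (intro exI[of _ "real (Suc n)"]) auto
qed

lemma depth_region_bounded:
  fixes P :: "'a::euclidean_space measure"
  assumes P: "P \<in> borel_distributions" and c: "0 < c"
  shows "bounded {x. c \<le> halfspace_depth x P}"
proof -
  interpret prob_space P using borel_distributionsD[OF P] by simp
  note [measurable_cong] = borel_distributionsD(2)[OF P]
  obtain r where r: "r > 0" "measure P {x. r \<le> norm (x - 0)} < c"
    using mass_far_away_small[OF P c] by blast
  have "norm x \<le> r" if x: "c \<le> halfspace_depth x P" for x
  proof (rule ccontr)
    assume "\<not> norm x \<le> r"
    then have nx: "r < norm x" "0 < norm x" using r by auto
    \<comment> \<open>The halfspace through \<open>x\<close> that faces away from the origin avoids the ball of radius \<open>r\<close>.\<close>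
    define u where "u = - (x /\<^sub>R norm x)"
    have u: "u \<in> sphere 0 1" using nx by (simp add: u_def)
    have xu: "x \<bullet> u = - norm x"
      using nx by (simp add: u_def dot_square_norm power2_eq_square)
    have "{y. y \<bullet> u \<le> x \<bullet> u} \<subseteq> {y. r \<le> norm (y - 0)}"
    proof safe
      fix y assume "y \<bullet> u \<le> x \<bullet> u"
      moreover have "\<bar>y \<bullet> u\<bar> \<le> norm y * norm u" by (rule Cauchy_Schwarz_ineq2)
      ultimately show "r \<le> norm (y - 0)" using u nx xu by simp
    qed
    moreover have "{y \<in> space P. r \<le> norm (y - 0)} \<in> sets P" by measurable
    then have "{y. r \<le> norm (y - 0)} \<in> sets P" using borel_distributionsD(3)[OF P] by simp
    ultimately have "hs_prob P u (x \<bullet> u) \<le> measure P {y. r \<le> norm (y - 0)}"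
      unfolding hs_prob_def by (rule finite_measure_mono)
    then show False using r(2) x halfspace_depth_le[OF u, of x P] by linarith
  qed
  then show ?thesis by (auto simp: bounded_iff)
qed

lemma unique_loc_median_depth_pos:
  fixes P :: "'a::euclidean_space measure"
  assumes "loc_median_set P = {a}"
  shows "0 < halfspace_depth a P"
proof (rule ccontr)
  assume neg: "\<not> 0 < halfspace_depth a P"
  have a: "halfspace_depth y P \<le> halfspace_depth a P" for y
    using assms by (auto simp: loc_median_set_def)
  have nn: "0 \<le> halfspace_depth y P" for y
    by (simp add: halfspace_depth_ge_iff hs_prob_def)
  have "halfspace_depth x P = 0" for x
    using nn[of x] a[of x] neg by linarith
  \<comment> \<open>All points have depth 0, so all are medians, yet the space has more than one point.\<close>
  then have "loc_median_set P = UNIV" by (auto simp: loc_median_set_def)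
  with assms have "(UNIV::'a set) = {a}" by simp
  moreover obtain b :: 'a where "norm b = 1"
    using vector_choose_size[of 1] by auto
  ultimately have "a + b = a" "b \<noteq> 0" by (auto simp: set_eq_iff)
  then show False by simp
qed

text \<open>
  The depths converge uniformly, so all medians of \<open>P n\<close> are eventually near the
  well-separated median of \<open>P0\<close>, and hence so is their barycenter.
\<close>
lemma loc_median_tendsto:
  fixes P0 :: "'a::euclidean_space measure"
  assumes P0: "P0 \<in> borel_distributions" "smooth_dist P0"
    and a: "loc_median_set P0 = {a}"
    and P: "eventually (\<lambda>n. P n \<in> borel_distributions) sequentially"
    and conv: "hs_converges P P0"
  shows "(\<lambda>n. loc_median (P n)) \<longlonglongrightarrow> a"
proof (rule tendstoI)
  fix e :: real assume "0 < e"
  then have e: "0 < e / 2" by simp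
  let ?D = "\<lambda>x. halfspace_depth x P0"
  let ?c = "?D a / 2"
  have pos: "0 < ?D a" by (rule unique_loc_median_depth_pos[OF a])
  have amax: "?D y \<le> ?D a" for y using a by (auto simp: loc_median_set_def)
  have "bounded {x. ?c \<le> ?D x}"
    using pos by (intro depth_region_bounded[OF P0(1)]) simp
  then have cpt: "compact {x. ?c \<le> ?D x}"
    using depth_region_closed_convex(1)[OF P0(1)] by (simp only: compact_eq_bounded_closed)
  have uniq: "?D y < ?D a" if "y \<noteq> a" for y
  proof -
    have "y \<notin> loc_median_set P0" using a that by simp
    then obtain z where "?D y < ?D z" by (auto simp: loc_median_set_def not_le)
    with amax[of z] show ?thesis by linarith
  qed
  have "\<exists>\<eta>>0. \<forall>y\<in>UNIV. ?D a - \<eta> \<le> ?D y \<longrightarrow> dist y a < e / 2"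
  proof (rule unique_maximiser_well_separated[OF cpt])
    show "continuous_on {x. ?c \<le> ?D x} ?D"
      by (rule continuous_on_subset[OF halfspace_depth_continuous[OF P0]]) simp
    show "?c < ?D a" using pos by simp
  qed (use uniq e in auto)
  then obtain \<eta> where \<eta>: "\<eta> > 0" "\<And>y. ?D a - \<eta> \<le> ?D y \<Longrightarrow> dist y a < e / 2"
    by blast
  have "eventually (\<lambda>n. \<forall>u\<in>sphere 0 1. \<forall>t.
      \<bar>hs_prob (P n) u t - hs_prob P0 u t\<bar> \<le> \<eta> / 2) sequentially"
    using \<eta>(1) by (intro hs_convergesD[OF conv]) simp
  with P show "eventually (\<lambda>n. dist (loc_median (P n)) a < e) sequentially"
  proof eventually_elim
    case (elim n)
    have close: "\<bar>halfspace_depth y (P n) - ?D y\<bar> \<le> \<eta> / 2" for y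
      by (rule halfspace_depth_close) (use elim(2) in blast)
    have sub: "{y. halfspace_depth a (P n) \<le> halfspace_depth y (P n)} \<subseteq> cball a (e / 2)"
    proof safe
      fix y assume "halfspace_depth a (P n) \<le> halfspace_depth y (P n)"
      then have "?D a - \<eta> \<le> ?D y" using close[of a] close[of y] by linarith
      then have "dist y a < e / 2" by (rule \<eta>(2))
      then show "y \<in> cball a (e / 2)" by (simp add: dist_commute)
    qed
    then have "bounded {y. halfspace_depth a (P n) \<le> halfspace_depth y (P n)}"
      using bounded_subset[OF bounded_cball] by blast
    then have ne: "loc_median_set (P n) \<noteq> {}"
      by (rule loc_median_set_nonempty[OF elim(1)])
    have "loc_median_set (P n) \<subseteq> {y. halfspace_depth a (P n) \<le> halfspace_depth y (P n)}"
      by (auto simp: loc_median_set_def)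
    with sub have L: "loc_median_set (P n) \<subseteq> cball a (e / 2)" by blast
    then have "compact (loc_median_set (P n))"
      using loc_median_set_closed_convex(1)[OF elim(1)] bounded_subset[OF bounded_cball L]
      by (simp add: compact_eq_bounded_closed)
    then have "loc_median (P n) \<in> cball a (e / 2)"
      unfolding loc_median_def
      using loc_median_set_closed_convex(2)[OF elim(1)] ne L by (rule barycenter_in_cball)
    then show ?case using e by (simp add: dist_commute)
  qed
qed

section \<open>The scatter depth\<close>

lemma slab_prob_eq:
  assumes P: "P \<in> borel_distributions" and r: "0 < r"
  shows "measure P {x. \<bar>(x - T) \<bullet> u\<bar> \<le> r} =
      hs_prob P u (T \<bullet> u + r) + hs_prob P (- u) (T \<bullet> (- u) + r) - 1"
    and "measure P {x. \<bar>(x - T) \<bullet> u\<bar> \<ge> r} =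
      hs_prob P u (T \<bullet> u - r) + hs_prob P (- u) (T \<bullet> (- u) - r)"
proof -
  interpret prob_space P using borel_distributionsD[OF P] by simp
  note [measurable_cong] = borel_distributionsD(2)[OF P]
  note space [simp] = borel_distributionsD(3)[OF P]
  have "{x \<in> space P. x \<bullet> v \<le> t} \<in> sets P" for v t by measurable
  then have hs: "{x. x \<bullet> v \<le> t} \<in> sets P" for v t by simp
  let ?H = "\<lambda>v t. {x. x \<bullet> v \<le> t}"
  have "?H u (T \<bullet> u + r) \<union> ?H (- u) (T \<bullet> (- u) + r) = space P"
    using r by auto
  moreover have "?H u (T \<bullet> u + r) \<inter> ?H (- u) (T \<bullet> (- u) + r) = {x. \<bar>(x - T) \<bullet> u\<bar> \<le> r}"
    by (auto simp: inner_diff_left)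
  moreover have "measure P (?H u (T \<bullet> u + r) \<union> ?H (- u) (T \<bullet> (- u) + r)) =
      measure P (?H u (T \<bullet> u + r)) + measure P (?H (- u) (T \<bullet> (- u) + r))
        - measure P (?H u (T \<bullet> u + r) \<inter> ?H (- u) (T \<bullet> (- u) + r))"
    by (rule measure_Un3) (use hs in \<open>auto simp: fmeasurable_eq_sets\<close>)
  ultimately show "measure P {x. \<bar>(x - T) \<bullet> u\<bar> \<le> r} =
      hs_prob P u (T \<bullet> u + r) + hs_prob P (- u) (T \<bullet> (- u) + r) - 1"
    unfolding hs_prob_def by (simp only: prob_space)
  have "{x. \<bar>(x - T) \<bullet> u\<bar> \<ge> r} = ?H u (T \<bullet> u - r) \<union> ?H (- u) (T \<bullet> (- u) - r)"
    by (auto simp: inner_diff_left abs_if)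
  moreover have "?H u (T \<bullet> u - r) \<inter> ?H (- u) (T \<bullet> (- u) - r) = {}"
    using r by auto
  ultimately show "measure P {x. \<bar>(x - T) \<bullet> u\<bar> \<ge> r} =
      hs_prob P u (T \<bullet> u - r) + hs_prob P (- u) (T \<bullet> (- u) - r)"
    unfolding hs_prob_def using finite_measure_Union[OF hs hs] by (simp only:)
qed

text \<open>The scatter depth with an arbitrary centre \<open>T\<close> in place of the location median.\<close>
definition scatter_depth_at :: "real^'d \<Rightarrow> real^'d^'d \<Rightarrow> (real^'d) measure \<Rightarrow> real" where
  "scatter_depth_at T S P =
     (INF u\<in>sphere 0 1.
        min (measure P {x. \<bar>(x - T) \<bullet> u\<bar> \<le> sqrt (u \<bullet> (S *v u))})
            (measure P {x. \<bar>(x - T) \<bullet> u\<bar> \<ge> sqrt (u \<bullet> (S *v u))}))"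

lemma scatter_depth_conv_at: "scatter_depth S P = scatter_depth_at (loc_median P) S P"
  by (simp add: scatter_depth_def scatter_depth_at_def)

lemma bdd_below_scatter:
  "bdd_below ((\<lambda>u. min (measure P (A u)) (measure P (B u))) ` U)"
  by (rule bdd_belowI[of _ 0]) auto

lemma scatter_depth_at_le:
  fixes T :: "real^'d"
  assumes "u \<in> sphere 0 1"
  shows "scatter_depth_at T S P \<le> measure P {x. \<bar>(x - T) \<bullet> u\<bar> \<le> sqrt (u \<bullet> (S *v u))}"
    and "scatter_depth_at T S P \<le> measure P {x. \<bar>(x - T) \<bullet> u\<bar> \<ge> sqrt (u \<bullet> (S *v u))}"
  using cINF_lower[OF bdd_below_scatter assms, of P
      "\<lambda>u. {x. \<bar>(x - T) \<bullet> u\<bar> \<le> sqrt (u \<bullet> (S *v u))}"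
      "\<lambda>u. {x. \<bar>(x - T) \<bullet> u\<bar> \<ge> sqrt (u \<bullet> (S *v u))}"]
  by (simp_all add: scatter_depth_at_def)

lemma scatter_depth_at_nonneg:
  fixes T :: "real^'d"
  shows "0 \<le> scatter_depth_at T S P"
  unfolding scatter_depth_at_def by (rule cINF_greatest) auto

lemma scatter_depth_at_le_1:
  fixes T :: "real^'d"
  assumes "prob_space P"
  shows "scatter_depth_at T S P \<le> 1"
proof -
  obtain u :: "real^'d" where "u \<in> sphere 0 1"
    using vector_choose_size[of 1] by auto
  from scatter_depth_at_le(1)[OF this, of T S P] show ?thesis
    using prob_space.prob_le_1[OF assms] order_trans by blast
qed

lemma PD_quadratic_form_pos: "S \<in> PD \<Longrightarrow> u \<in> sphere 0 1 \<Longrightarrow> 0 < u \<bullet> (S *v u)"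
proof -
  assume "S \<in> PD" "u \<in> sphere 0 1"
  moreover from this have "u \<noteq> 0" by auto
  ultimately show ?thesis by (simp add: PD_def)
qed

text \<open>
  The two slab probabilities are sums of two halfspace probabilities, so closeness of the
  latter carries over to the depth, at the cost of a factor 2; the distribution, the centre and
  the matrix may all change.
\<close>
lemma scatter_depth_at_close:
  fixes S S' :: "real^'d^'d"
  assumes P: "P \<in> borel_distributions" and Q: "Q \<in> borel_distributions"
    and S: "S \<in> PD" and S': "S' \<in> PD"
    and up: "\<And>u. u \<in> sphere 0 1 \<Longrightarrow>
      \<bar>hs_prob P u (T \<bullet> u + sqrt (u \<bullet> (S *v u))) - hs_prob Q u (T' \<bullet> u + sqrt (u \<bullet> (S' *v u)))\<bar> \<le> e"
    and lo: "\<And>u. u \<in> sphere 0 1 \<Longrightarrow>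
      \<bar>hs_prob P u (T \<bullet> u - sqrt (u \<bullet> (S *v u))) - hs_prob Q u (T' \<bullet> u - sqrt (u \<bullet> (S' *v u)))\<bar> \<le> e"
  shows "\<bar>scatter_depth_at T S P - scatter_depth_at T' S' Q\<bar> \<le> 2 * e"
  unfolding scatter_depth_at_def
proof (rule abs_INF_diff_le[OF _ bdd_below_scatter bdd_below_scatter])
  show "sphere (0::real^'d) 1 \<noteq> {}" by simp
  fix u :: "real^'d" assume u: "u \<in> sphere 0 1"
  then have mu: "- u \<in> sphere 0 1" by simp
  have neg: "(- u) \<bullet> (A *v (- u)) = u \<bullet> (A *v u)" for A :: "real^'d^'d"
    by (simp add: linear_neg[OF matrix_vector_mul_linear])
  have r: "0 < sqrt (u \<bullet> (S *v u))" "0 < sqrt (u \<bullet> (S' *v u))"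
    using PD_quadratic_form_pos[OF S u] PD_quadratic_form_pos[OF S' u] by auto
  have min_diff: "\<bar>min a b - min c d\<bar> \<le> k" if "\<bar>a - c\<bar> \<le> k" "\<bar>b - d\<bar> \<le> k" for a b c d k :: real
    using that by (auto simp: min_def)
  have sum_diff: "\<bar>(a + b) - (c + d)\<bar> \<le> 2 * e" and sum_diff': "\<bar>(a + b - 1) - (c + d - 1)\<bar> \<le> 2 * e"
    if "\<bar>a - c\<bar> \<le> e" "\<bar>b - d\<bar> \<le> e" for a b c d
    using that by linarith+
  show "\<bar>min (measure P {x. \<bar>(x - T) \<bullet> u\<bar> \<le> sqrt (u \<bullet> (S *v u))})
             (measure P {x. sqrt (u \<bullet> (S *v u)) \<le> \<bar>(x - T) \<bullet> u\<bar>}) -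
         min (measure Q {x. \<bar>(x - T') \<bullet> u\<bar> \<le> sqrt (u \<bullet> (S' *v u))})
             (measure Q {x. sqrt (u \<bullet> (S' *v u)) \<le> \<bar>(x - T') \<bullet> u\<bar>})\<bar> \<le> 2 * e"
    unfolding slab_prob_eq[OF P r(1)] slab_prob_eq[OF Q r(2)]
    by (intro min_diff sum_diff sum_diff' up[OF u] lo[OF u] up[OF mu, unfolded neg]
        lo[OF mu, unfolded neg])
qed

text \<open>
  Closeness uniformly over all of \<open>PD\<close>: the change of the distribution is controlled by the
  halfspace metric, and the change of the centre by uniform continuity of \<open>hs_prob P0\<close>.
\<close>
lemma scatter_depth_uniformly_close:
  fixes P0 :: "(real^'d) measure"
  assumes P0: "P0 \<in> borel_distributions" "smooth_dist P0"
    and a: "loc_median_set P0 = {a}"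
    and P: "eventually (\<lambda>n. P n \<in> borel_distributions) sequentially"
    and conv: "hs_converges P P0" and e: "0 < e"
  shows "eventually (\<lambda>n. \<forall>S\<in>PD. \<bar>scatter_depth S (P n) - scatter_depth S P0\<bar> \<le> e) sequentially"
proof -
  have e4: "0 < e / 4" using e by simp
  obtain d where d: "d > 0" "\<And>u s t. u \<in> sphere 0 1 \<Longrightarrow> \<bar>s - t\<bar> \<le> d \<Longrightarrow>
      \<bar>hs_prob P0 u s - hs_prob P0 u t\<bar> \<le> e / 4"
    using hs_prob_uniformly_continuous[OF P0 e4] by blast
  have T0: "loc_median P0 = a"
    by (simp add: loc_median_def a barycenter_singleton)
  have "eventually (\<lambda>n. dist (loc_median (P n)) a < d) sequentially"
    using loc_median_tendsto[OF P0 a P conv] d(1) by (rule tendstoD)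
  moreover have "eventually (\<lambda>n. \<forall>u\<in>sphere 0 1. \<forall>t.
      \<bar>hs_prob (P n) u t - hs_prob P0 u t\<bar> \<le> e / 4) sequentially"
    by (rule hs_convergesD[OF conv e4])
  ultimately show ?thesis
    using P
  proof eventually_elim
    case (elim n)
    show ?case
    proof
      fix S :: "real^'d^'d" assume S: "S \<in> PD"
      let ?T = "loc_median (P n)"
      have "\<bar>hs_prob (P n) u (?T \<bullet> u + r) - hs_prob P0 u (a \<bullet> u + r)\<bar> \<le> e / 2"
        if u: "u \<in> sphere 0 1" for u r
      proof -
        have "\<bar>?T \<bullet> u - a \<bullet> u\<bar> \<le> norm (?T - a) * norm u"
          unfolding inner_diff_left[symmetric] by (rule Cauchy_Schwarz_ineq2)
        also have "\<dots> \<le> d" using elim(1) u by (simp add: dist_norm)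
        finally have "\<bar>hs_prob P0 u (?T \<bullet> u + r) - hs_prob P0 u (a \<bullet> u + r)\<bar> \<le> e / 4"
          by (intro d(2) u) simp
        moreover have "\<bar>hs_prob (P n) u (?T \<bullet> u + r) - hs_prob P0 u (?T \<bullet> u + r)\<bar> \<le> e / 4"
          using elim(2) u by blast
        ultimately show ?thesis by linarith
      qed
      from this this[of _ "- r" for r]
      have "\<bar>scatter_depth_at ?T S (P n) - scatter_depth_at a S P0\<bar> \<le> 2 * (e / 2)"
        by (intro scatter_depth_at_close[OF elim(3) P0(1) S S]) auto
      then show "\<bar>scatter_depth S (P n) - scatter_depth S P0\<bar> \<le> e"
        by (simp add: scatter_depth_conv_at T0)
    qed
  qed
qed

lemma norm_matrix_vector_mult_le:
  fixes A :: "real^'n^'m"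
  shows "norm (A *v x) \<le> norm A * norm x"
proof -
  have "norm (A *v x) = L2_set (\<lambda>i. norm (A $ i \<bullet> x)) UNIV"
    by (simp add: norm_vec_def matrix_vector_mul_component)
  also have "\<dots> \<le> L2_set (\<lambda>i. norm x * norm (A $ i)) UNIV"
    by (rule L2_set_mono) (simp_all add: mult.commute[of "norm x"] Cauchy_Schwarz_ineq2)
  also have "\<dots> = norm x * norm A"
    unfolding norm_vec_def[of A] by (simp add: L2_set_right_distrib)
  finally show ?thesis by (simp add: mult.commute)
qed

lemma abs_sqrt_diff_le:
  assumes "0 \<le> x" "0 \<le> y" "0 \<le> d" "\<bar>x - y\<bar> \<le> d\<^sup>2"
  shows "\<bar>sqrt x - sqrt y\<bar> \<le> d"
proof -
  have *: "sqrt b \<le> sqrt a + d" if "0 \<le> a" "b \<le> a + d\<^sup>2" for a b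
  proof (rule real_le_lsqrt)
    have "0 \<le> 2 * sqrt a * d" using that assms(3) by simp
    then show "b \<le> (sqrt a + d)\<^sup>2"
      using that by (simp add: power2_sum mult.commute)
    show "0 \<le> sqrt a + d" using that assms(3) by simp
  qed
  from *[of x y] *[of y x] assms show ?thesis by (auto simp: abs_le_iff)
qed

lemma scatter_depth_continuous:
  fixes P :: "(real^'d) measure"
  assumes P: "P \<in> borel_distributions" "smooth_dist P"
  shows "continuous_on PD (\<lambda>S. scatter_depth S P)"
  unfolding continuous_on_iff
proof (intro ballI allI impI)
  fix S :: "real^'d^'d" and e :: real assume S: "S \<in> PD" and e: "0 < e"
  let ?T = "loc_median P"
  from e have e4: "0 < e / 4" by simp
  obtain d where d: "d > 0" "\<And>u s t. u \<in> sphere 0 1 \<Longrightarrow> \<bar>s - t\<bar> \<le> d \<Longrightarrow>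
      \<bar>hs_prob P u s - hs_prob P u t\<bar> \<le> e / 4"
    using hs_prob_uniformly_continuous[OF P e4] by blast
  have "dist (scatter_depth S' P) (scatter_depth S P) < e"
    if S': "S' \<in> PD" and dist: "dist S' S < d\<^sup>2" for S'
  proof -
    have rad: "\<bar>sqrt (u \<bullet> (S' *v u)) - sqrt (u \<bullet> (S *v u))\<bar> \<le> d" if u: "u \<in> sphere 0 1" for u
    proof (rule abs_sqrt_diff_le)
      have "\<bar>u \<bullet> (S' *v u) - u \<bullet> (S *v u)\<bar> = \<bar>u \<bullet> ((S' - S) *v u)\<bar>"
        by (simp add: matrix_vector_mult_diff_rdistrib inner_diff_right)
      also have "\<dots> \<le> norm u * norm ((S' - S) *v u)" by (rule Cauchy_Schwarz_ineq2)
      also have "\<dots> \<le> norm (S' - S)"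
        using norm_matrix_vector_mult_le[of "S' - S" u] u by simp
      finally show "\<bar>u \<bullet> (S' *v u) - u \<bullet> (S *v u)\<bar> \<le> d\<^sup>2"
        using dist by (simp add: dist_norm)
    qed (use PD_quadratic_form_pos[OF S u] PD_quadratic_form_pos[OF S' u] d(1) in auto)
    have "\<bar>scatter_depth_at ?T S' P - scatter_depth_at ?T S P\<bar> \<le> 2 * (e / 4)"
      by (intro scatter_depth_at_close[OF P(1) P(1) S' S] d(2))
        (use rad in \<open>auto simp: abs_minus_commute\<close>)
    then show ?thesis using e by (simp add: scatter_depth_conv_at dist_real_def)
  qed
  then show "\<exists>d>0. \<forall>S'\<in>PD. dist S' S < d \<longrightarrow> dist (scatter_depth S' P) (scatter_depth S P) < e"
    using d(1) by (intro exI[of _ "d\<^sup>2"]) auto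
qed

section \<open>Compactness of scatter depth regions\<close>

text \<open>The symmetric matrices with spectrum in \<open>[lo, hi]\<close>, by their quadratic forms.\<close>
definition spectral_box :: "real \<Rightarrow> real \<Rightarrow> (real^'d^'d) set" where
  "spectral_box lo hi = {S. transpose S = S \<and>
     (\<forall>x. lo * (x \<bullet> x) \<le> x \<bullet> (S *v x) \<and> x \<bullet> (S *v x) \<le> hi * (x \<bullet> x))}"

lemma spectral_box_subset_PD: "0 < lo \<Longrightarrow> spectral_box lo hi \<subseteq> PD"
  unfolding spectral_box_def PD_def
  by (auto intro!: less_le_trans[of 0 "lo * (x \<bullet> x)" "x \<bullet> (S *v x)" for x S])

lemma inner_axis_matrix_vector:
  fixes S :: "real^'d^'d"
  shows "axis i 1 \<bullet> (S *v axis j 1) = S $ i $ j"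
  by (simp add: inner_axis' matrix_vector_mult_basis column_def)

text \<open>Boundedness comes from evaluating the quadratic form at \<open>e\<^sub>i + e\<^sub>j\<close> and \<open>e\<^sub>i - e\<^sub>j\<close>.\<close>
lemma compact_spectral_box:
  assumes "0 \<le> lo"
  shows "compact (spectral_box lo hi :: (real^'d^'d) set)"
  unfolding compact_eq_bounded_closed
proof
  have entry: "\<bar>S $ i $ j\<bar> \<le> \<bar>hi\<bar>" if S: "S \<in> spectral_box lo hi" for S :: "real^'d^'d" and i j
  proof -
    let ?e = "\<lambda>k. axis k (1::real) :: real^'d"
    have nn: "0 \<le> x \<bullet> (S *v x)" for x
      using S assms by (auto simp: spectral_box_def intro: order_trans[of 0 "lo * (x \<bullet> x)"])
    have diag: "S $ k $ k \<le> hi" for k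
    proof -
      have "?e k \<bullet> (S *v ?e k) \<le> hi * (?e k \<bullet> ?e k)"
        using S unfolding spectral_box_def by blast
      then show ?thesis by (simp add: inner_axis_matrix_vector inner_axis_axis)
    qed
    have sym: "S $ j $ i = S $ i $ j"
    proof -
      have "transpose S = S" using S by (simp add: spectral_box_def)
      then have "transpose S $ i $ j = S $ i $ j" by simp
      then show ?thesis by (simp add: transpose_def)
    qed
    have "0 \<le> S $ i $ i + 2 * S $ i $ j + S $ j $ j"
      using nn[of "?e i + ?e j"] sym
      by (simp add: matrix_vector_right_distrib inner_add_left inner_add_right
          inner_axis_matrix_vector)
    moreover have "0 \<le> S $ i $ i - 2 * S $ i $ j + S $ j $ j"
      using nn[of "?e i - ?e j"] sym
      by (simp add: matrix_vector_mult_diff_distrib inner_diff_left inner_diff_right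
          inner_axis_matrix_vector)
    ultimately show ?thesis using diag[of i] diag[of j] by linarith
  qed
  have "norm S \<le> (\<Sum>i\<in>(UNIV::'d set). \<Sum>j\<in>(UNIV::'d set). \<bar>hi\<bar>)" if "S \<in> spectral_box lo hi" for S :: "real^'d^'d"
  proof -
    have "norm S \<le> (\<Sum>i\<in>UNIV. norm (S $ i))"
      unfolding norm_vec_def[of S] by (rule L2_set_le_sum) simp
    also have "\<dots> \<le> (\<Sum>i\<in>UNIV. \<Sum>j\<in>UNIV. \<bar>S $ i $ j\<bar>)"
      by (intro sum_mono norm_le_l1_cart)
    also have "\<dots> \<le> (\<Sum>i\<in>(UNIV::'d set). \<Sum>j\<in>(UNIV::'d set). \<bar>hi\<bar>)"
      by (intro sum_mono entry that)
    finally show ?thesis .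
  qed
  from boundedI[OF this] show "bounded (spectral_box lo hi :: (real^'d^'d) set)"
    .
  have lin: "continuous_on UNIV (\<lambda>S::real^'d^'d. x \<bullet> (S *v x))" for x
    unfolding matrix_vector_mult_def by (intro continuous_intros)
  have tr: "continuous_on UNIV (transpose :: real^'d^'d \<Rightarrow> _)"
    unfolding transpose_def by (intro continuous_intros)
  show "closed (spectral_box lo hi :: (real^'d^'d) set)"
    unfolding spectral_box_def
    by (intro closed_Collect_conj closed_Collect_all closed_Collect_le closed_Collect_eq
        lin tr continuous_on_const continuous_on_id)
qed

text \<open>
  If \<open>S\<close> has positive depth then its quadratic form can be small in no direction, as the thin
  slab around a hyperplane has little mass, and large in none, as little mass is far away.
\<close>
lemma scatter_depth_region_spectral_box:
  fixes P :: "(real^'d) measure"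
  assumes P: "P \<in> borel_distributions" "smooth_dist P" and c: "0 < c"
  shows "\<exists>lo hi. 0 < lo \<and> (\<forall>S\<in>PD. c \<le> scatter_depth S P \<longrightarrow> S \<in> spectral_box lo hi)"
proof -
  interpret prob_space P using borel_distributionsD[OF P(1)] by simp
  note [measurable_cong] = borel_distributionsD(2)[OF P(1)]
  note space [simp] = borel_distributionsD(3)[OF P(1)]
  let ?T = "loc_median P"
  obtain \<delta> where \<delta>: "\<delta> > 0"
    "\<And>w. 1 \<le> norm w \<Longrightarrow> measure P {x. \<bar>hs_form w x\<bar> \<le> \<delta>} \<le> c / 2"
    using smooth_thin_slabs[OF P, of "c / 2"] c by auto
  obtain R where R: "R > 0" "measure P {x. R \<le> norm (x - ?T)} < c"
    using mass_far_away_small[OF P(1) c] by blast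
  have box: "S \<in> spectral_box (\<delta>\<^sup>2) (R\<^sup>2)" if S: "S \<in> PD" and dep: "c \<le> scatter_depth S P" for S
  proof -
    have unit: "\<delta>\<^sup>2 \<le> u \<bullet> (S *v u) \<and> u \<bullet> (S *v u) \<le> R\<^sup>2" if u: "u \<in> sphere 0 1" for u
    proof -
      let ?r = "sqrt (u \<bullet> (S *v u))"
      have r: "?r\<^sup>2 = u \<bullet> (S *v u)"
        using PD_quadratic_form_pos[OF S u] by simp
      have "0 \<le> ?r" using PD_quadratic_form_pos[OF S u] by simp
      have "\<delta> \<le> ?r"
      proof (rule ccontr)
        assume "\<not> \<delta> \<le> ?r"
        have "{x. \<bar>(x - ?T) \<bullet> u\<bar> \<le> ?r} \<subseteq> {x. \<bar>hs_form (u, ?T \<bullet> u) x\<bar> \<le> \<delta>}"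
        proof safe
          fix x assume "\<bar>(x - ?T) \<bullet> u\<bar> \<le> ?r"
          with abs_hs_form_le[of u "?T \<bullet> u" x] \<open>\<not> \<delta> \<le> ?r\<close>
          show "\<bar>hs_form (u, ?T \<bullet> u) x\<bar> \<le> \<delta>" by (simp add: inner_diff_left)
        qed
        moreover have "{x \<in> space P. \<bar>hs_form (u, ?T \<bullet> u) x\<bar> \<le> \<delta>} \<in> sets P" by measurable
        then have "{x. \<bar>hs_form (u, ?T \<bullet> u) x\<bar> \<le> \<delta>} \<in> sets P" by simp
        ultimately have "measure P {x. \<bar>(x - ?T) \<bullet> u\<bar> \<le> ?r} \<le>
            measure P {x. \<bar>hs_form (u, ?T \<bullet> u) x\<bar> \<le> \<delta>}"
          by (rule finite_measure_mono)
        also have "\<dots> \<le> c / 2"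
          using \<delta>(2)[of "(u, ?T \<bullet> u)"] norm_fst_le[of u "?T \<bullet> u"] u by simp
        finally show False
          using scatter_depth_at_le(1)[OF u, of ?T S P] dep c
          by (simp add: scatter_depth_conv_at)
      qed
      moreover have "?r \<le> R"
      proof (rule ccontr)
        assume "\<not> ?r \<le> R"
        have "{x. ?r \<le> \<bar>(x - ?T) \<bullet> u\<bar>} \<subseteq> {x. R \<le> norm (x - ?T)}"
        proof safe
          fix x assume "?r \<le> \<bar>(x - ?T) \<bullet> u\<bar>"
          moreover have "\<bar>(x - ?T) \<bullet> u\<bar> \<le> norm (x - ?T) * norm u"
            by (rule Cauchy_Schwarz_ineq2)
          ultimately show "R \<le> norm (x - ?T)" using u \<open>\<not> ?r \<le> R\<close> by simp
        qed
        moreover have "{x \<in> space P. R \<le> norm (x - ?T)} \<in> sets P" by measurable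
        then have "{x. R \<le> norm (x - ?T)} \<in> sets P" by simp
        ultimately have "measure P {x. ?r \<le> \<bar>(x - ?T) \<bullet> u\<bar>} \<le> measure P {x. R \<le> norm (x - ?T)}"
          by (rule finite_measure_mono)
        then show False
          using scatter_depth_at_le(2)[OF u, of ?T S P] dep R(2)
          by (simp add: scatter_depth_conv_at)
      qed
      ultimately have "\<delta>\<^sup>2 \<le> ?r\<^sup>2" "?r\<^sup>2 \<le> R\<^sup>2"
        using \<delta>(1) \<open>0 \<le> ?r\<close> by (auto intro!: power_mono simp del: real_sqrt_pow2_iff real_sqrt_pow2)
      then show ?thesis by (simp only: r simp_thms)
    qed
    have "\<delta>\<^sup>2 * (x \<bullet> x) \<le> x \<bullet> (S *v x) \<and> x \<bullet> (S *v x) \<le> R\<^sup>2 * (x \<bullet> x)" for x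
    proof (cases "x = 0")
      case False
      define u where "u = x /\<^sub>R norm x"
      have x: "x = norm x *\<^sub>R u" and u: "u \<in> sphere 0 1" using False by (auto simp: u_def)
      have "x \<bullet> (S *v x) = (norm x)\<^sup>2 * (u \<bullet> (S *v u))"
        by (subst (1 2) x) (simp add: power2_eq_square matrix_vector_mult_scaleR)
      then show ?thesis
        using unit[OF u] by (simp add: dot_square_norm mult.commute[of _ "(norm x)\<^sup>2"]
            mult_left_mono del: mult_le_cancel_left)
    qed simp
    moreover have "transpose S = S" using S by (simp add: PD_def)
    ultimately show ?thesis by (simp add: spectral_box_def)
  qed
  moreover have "0 < \<delta>\<^sup>2" using \<delta>(1) by simp
  ultimately show ?thesis by blast
qed

section \<open>Consistency of the scatter median\<close>

lemma bdd_above_scatter_depth: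
  "P \<in> borel_distributions \<Longrightarrow> bdd_above ((\<lambda>S. scatter_depth S P) ` A)"
  using scatter_depth_at_le_1[OF borel_distributionsD(1)]
  by (intro bdd_aboveI[of _ 1]) (auto simp: scatter_depth_conv_at)

lemma scatter_median_setD:
  assumes P: "P \<in> borel_distributions" and S: "S \<in> scatter_median_set P"
  shows "S \<in> PD" "\<And>S'. S' \<in> PD \<Longrightarrow> scatter_depth S' P \<le> scatter_depth S P"
  using S cSUP_upper[OF _ bdd_above_scatter_depth[OF P]] by (auto simp: scatter_median_set_def)

lemma scatter_median_setI:
  assumes P: "P \<in> borel_distributions"
    and S: "S \<in> PD" "\<And>S'. S' \<in> PD \<Longrightarrow> scatter_depth S' P \<le> scatter_depth S P"
  shows "S \<in> scatter_median_set P"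
proof -
  have "(SUP S'\<in>PD. scatter_depth S' P) \<le> scatter_depth S P"
    using S by (intro cSUP_least) auto
  moreover have "scatter_depth S P \<le> (SUP S'\<in>PD. scatter_depth S' P)"
    by (rule cSUP_upper[OF S(1) bdd_above_scatter_depth[OF P]])
  ultimately show ?thesis using S(1) by (simp add: scatter_median_set_def)
qed

lemma unique_scatter_median_depth_pos:
  fixes P :: "(real^'d) measure"
  assumes P: "P \<in> borel_distributions" and S: "scatter_median_set P = {S}"
  shows "0 < scatter_depth S P"
proof (rule ccontr)
  assume neg: "\<not> 0 < scatter_depth S P"
  have med: "S \<in> scatter_median_set P" using S by simp
  note SD = scatter_median_setD[OF P med]
  have zero: "scatter_depth S' P = 0" if "S' \<in> PD" for S'
    using SD(2)[OF that] neg scatter_depth_at_nonneg[of "loc_median P" S' P]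
    by (simp add: scatter_depth_conv_at)
  \<comment> \<open>If the maximal depth were 0, all positive definite matrices would be medians.\<close>
  have pd: "S + S \<in> PD"
  proof -
    have "transpose S = S" "\<And>x. x \<noteq> 0 \<Longrightarrow> 0 < x \<bullet> (S *v x)" using SD(1) by (auto simp: PD_def)
    moreover have "transpose (S + S) = transpose S + transpose S"
      by (simp add: transpose_def vec_eq_iff)
    ultimately show ?thesis
      unfolding PD_def mem_Collect_eq matrix_vector_mult_add_rdistrib inner_add_right
      by (intro conjI allI impI add_pos_pos) (simp_all only:)
  qed
  then have "S + S \<in> scatter_median_set P"
    using zero by (intro scatter_median_setI[OF P]) auto
  with S have "S + S = S" by simp
  then have "S = 0" by simp
  moreover obtain u :: "real^'d" where "u \<in> sphere 0 1"
    using vector_choose_size[of 1] by auto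
  ultimately show False using PD_quadratic_form_pos[OF SD(1)] by fastforce
qed

text \<open>
  The deterministic core of both consistency results: by uniform closeness of the depths,
  \<open>S n\<close> nearly maximises the depth of \<open>P0\<close>, and the unique maximiser is well separated because
  the continuous depth of \<open>P0\<close> is at least half its maximum only on a compact part of \<open>PD\<close>.
\<close>
lemma scatter_median_tendsto:
  fixes P0 :: "(real^'d) measure"
  assumes P0: "P0 \<in> borel_distributions" "smooth_dist P0"
    and loc: "is_singleton (loc_median_set P0)"
    and sc: "scatter_median_set P0 = {S0}"
    and P: "eventually (\<lambda>n. P n \<in> borel_distributions) sequentially"
    and conv: "hs_converges P P0"
    and S: "eventually (\<lambda>n. S n \<in> scatter_median_set (P n)) sequentially"
  shows "S \<longlonglongrightarrow> S0"
proof (rule tendstoI)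
  fix e :: real assume e: "0 < e"
  obtain a where a: "loc_median_set P0 = {a}" using loc by (auto simp: is_singleton_def)
  let ?D = "\<lambda>S. scatter_depth S P0"
  have S0: "S0 \<in> scatter_median_set P0" using sc by simp
  note S0D = scatter_median_setD[OF P0(1) S0]
  have pos: "0 < ?D S0" by (rule unique_scatter_median_depth_pos[OF P0(1) sc])
  then have "0 < ?D S0 / 2" by simp
  from scatter_depth_region_spectral_box[OF P0 this] obtain lo hi where box: "0 < lo"
    "\<And>S. S \<in> PD \<Longrightarrow> ?D S0 / 2 \<le> ?D S \<Longrightarrow> S \<in> spectral_box lo hi" by blast
  have uniq: "?D S < ?D S0" if "S \<in> PD" "S \<noteq> S0" for S
  proof (rule ccontr)
    assume "\<not> ?D S < ?D S0"
    then have "?D S' \<le> ?D S" if "S' \<in> PD" for S'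
      using S0D(2)[OF that] by linarith
    then have "S \<in> scatter_median_set P0"
      using \<open>S \<in> PD\<close> by (intro scatter_median_setI[OF P0(1)])
    with sc that show False by simp
  qed
  note sub = spectral_box_subset_PD[OF box(1), of hi]
  have "\<exists>\<eta>>0. \<forall>S\<in>PD. ?D S0 - \<eta> \<le> ?D S \<longrightarrow> dist S S0 < e"
  proof (rule unique_maximiser_well_separated[where K = "spectral_box lo hi" and c = "?D S0 / 2"])
    show "compact (spectral_box lo hi :: (real^'d^'d) set)"
      using box(1) by (intro compact_spectral_box) simp
    show "continuous_on (spectral_box lo hi) ?D"
      using scatter_depth_continuous[OF P0] sub by (rule continuous_on_subset)
  qed (use box(2) pos uniq sub e in auto)
  then obtain \<eta> where \<eta>: "\<eta> > 0" "\<And>S. S \<in> PD \<Longrightarrow> ?D S0 - \<eta> \<le> ?D S \<Longrightarrow> dist S S0 < e"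
    by blast
  have "eventually (\<lambda>n. \<forall>S\<in>PD. \<bar>scatter_depth S (P n) - ?D S\<bar> \<le> \<eta> / 2) sequentially"
    using \<eta>(1) by (intro scatter_depth_uniformly_close[OF P0 a P conv]) simp
  then show "eventually (\<lambda>n. dist (S n) S0 < e) sequentially"
    using P S
  proof eventually_elim
    case (elim n)
    note SnD = scatter_median_setD[OF elim(2,3)]
    have "scatter_depth S0 (P n) \<le> scatter_depth (S n) (P n)"
      by (rule SnD(2)[OF S0D(1)])
    moreover have "\<bar>scatter_depth S0 (P n) - ?D S0\<bar> \<le> \<eta> / 2"
      "\<bar>scatter_depth (S n) (P n) - ?D (S n)\<bar> \<le> \<eta> / 2"
      using elim(1) S0D(1) SnD(1) by blast+
    ultimately have "?D S0 - \<eta> \<le> ?D (S n)" by linarith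
    with SnD(1) show ?case by (rule \<eta>(2))
  qed
qed

section \<open>Empirical distributions\<close>

lemma measurable_uniform_count_measure [simp]:
  "x \<in> measurable (uniform_count_measure A) borel"
  by (simp add: measurable_def sets_uniform_count_measure space_uniform_count_measure)

lemma empirical_in_borel_distributions:
  assumes "1 \<le> n"
  shows "empirical n x \<in> borel_distributions"
proof -
  interpret prob_space "uniform_count_measure {1..n}"
    using assms by (intro prob_space_uniform_count_measure) auto
  show ?thesis
    unfolding borel_distributions_def empirical_def
    using prob_space_distr[OF measurable_uniform_count_measure] by simp
qed

lemma integral_empirical:
  fixes f :: "'a::euclidean_space \<Rightarrow> real"
  assumes "f \<in> borel_measurable borel"
  shows "(\<integral>y. f y \<partial>empirical n x) = (\<Sum>i=1..n. f (x i)) / real n"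
  unfolding empirical_def using assms
  by (subst integral_distr) (simp_all add: integral_uniform_count_measure)

text \<open>
  The strong law of large numbers for bounded functions of a random sample: by Hoeffding's
  inequality the probabilities of a deviation by a fixed amount are summable.
\<close>
lemma random_sample_strong_law:
  fixes f :: "'a::euclidean_space \<Rightarrow> real"
  assumes X: "random_sample M P X"
    and f: "f \<in> borel_measurable borel" "range f \<subseteq> {0..1}"
  shows "AE w in M. (\<lambda>n. (\<Sum>i=1..n. f (X i w)) / real n) \<longlonglongrightarrow> (\<integral>x. f x \<partial>P)"
proof -
  interpret prob_space M using X by (simp add: random_sample_def)
  have ind: "indep_vars (\<lambda>_. borel) X {1..}" and D: "\<And>i. 1 \<le> i \<Longrightarrow> distr M borel (X i) = P"
    using X by (auto simp: random_sample_def)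
  have rv: "X i \<in> borel_measurable M" if "1 \<le> i" for i
    using ind that by (auto simp: indep_vars_def)
  let ?\<mu> = "\<integral>x. f x \<partial>P"
  have E: "expectation (\<lambda>w. f (X i w)) = ?\<mu>" if "1 \<le> i" for i
    unfolding D[OF that, symmetric] using rv[OF that] f(1) by (simp add: integral_distr)
  \<comment> \<open>The deviation event for the sample of size \<open>Suc n\<close>; the empty sample is left out.\<close>
  define A where "A d n = {w \<in> space M. \<bar>(\<Sum>i=1..Suc n. f (X i w)) - real (Suc n) * ?\<mu>\<bar> \<ge> real (Suc n) * d}"
    for d n
  have bound: "prob (A d n) \<le> 2 * exp (- 2 * d\<^sup>2) ^ Suc n" if d: "0 < d" for d n
  proof -
    interpret H: Hoeffding_ineq M "{1..Suc n}" "\<lambda>i w. f (X i w)" "\<lambda>_. 0" "\<lambda>_. 1"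
      "\<Sum>i\<in>{1..Suc n}. expectation (\<lambda>w. f (X i w))"
    proof unfold_locales
      have "indep_vars (\<lambda>_. borel) X {1..Suc n}"
        using ind by (rule indep_vars_subset) auto
      then show "indep_vars (\<lambda>_. borel) (\<lambda>i w. f (X i w)) {1..Suc n}"
        by (rule indep_vars_compose2) (rule f(1))
    qed (use f(2) in \<open>auto simp: image_subset_iff\<close>)
    have "(\<Sum>i\<in>{1..Suc n}. expectation (\<lambda>w. f (X i w))) = real (Suc n) * ?\<mu>"
      using E by simp
    with H.Hoeffding_ineq_abs_ge[of "real (Suc n) * d"] d
    have "prob (A d n) \<le> 2 * exp (- 2 * (real (Suc n) * d)\<^sup>2 / real (Suc n))"
      unfolding A_def by simp
    also have "- 2 * (real (Suc n) * d)\<^sup>2 / real (Suc n) = real (Suc n) * (- 2 * d\<^sup>2)"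
      by (simp add: power2_eq_square)
    also have "exp \<dots> = exp (- 2 * d\<^sup>2) ^ Suc n" by (rule exp_of_nat_mult)
    finally show ?thesis .
  qed
  have "AE w in M. eventually (\<lambda>n. w \<in> space M - A d n) sequentially" if d: "0 < d" for d
  proof (rule borel_cantelli_AE1)
    show "A d n \<in> sets M" for n
    proof -
      have [measurable]: "(\<lambda>w. f (X i w)) \<in> borel_measurable M" if "i \<in> {1..Suc n}" for i
        using rv[of i] f(1) that by simp
      show ?thesis unfolding A_def by measurable
    qed
    show "summable (\<lambda>n. prob (A d n))"
    proof (rule summable_comparison_test')
      have "norm (exp (- 2 * d\<^sup>2)) < 1" using d by simp
      then have "summable (\<lambda>n. exp (- 2 * d\<^sup>2) ^ n)" by (rule summable_geometric)
      then show "summable (\<lambda>n. 2 * exp (- 2 * d\<^sup>2) ^ Suc n)"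
        by (intro summable_mult) (simp add: summable_Suc_iff del: power_Suc)
      show "norm (prob (A d n)) \<le> 2 * exp (- 2 * d\<^sup>2) ^ Suc n" for n
        using bound[OF d, of n] by simp
    qed
  qed (simp add: emeasure_eq_measure)
  then have "AE w in M. \<forall>k. eventually (\<lambda>n. w \<in> space M - A (inverse (real (Suc k))) n) sequentially"
    by (intro AE_all_countable[THEN iffD2] allI) simp
  then show ?thesis
  proof eventually_elim
    case (elim w)
    have "(\<lambda>n. (\<Sum>i=1..Suc n. f (X i w)) / real (Suc n)) \<longlonglongrightarrow> ?\<mu>"
    proof (rule tendstoI)
      fix e :: real assume "0 < e"
      then obtain k where k: "inverse (real (Suc k)) < e" using reals_Archimedean by blast
      show "eventually (\<lambda>n. dist ((\<Sum>i=1..Suc n. f (X i w)) / real (Suc n)) ?\<mu> < e) sequentially"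
        using elim[rule_format, of k]
      proof eventually_elim
        case (elim n)
        let ?s = "\<Sum>i=1..Suc n. f (X i w)"
        from elim have "\<bar>?s - real (Suc n) * ?\<mu>\<bar> < real (Suc n) * inverse (real (Suc k))"
          by (auto simp: A_def simp del: sum.cl_ivl_Suc)
        also have "\<dots> < real (Suc n) * e" using k by (intro mult_strict_left_mono) auto
        finally have "\<bar>?s - real (Suc n) * ?\<mu>\<bar> / real (Suc n) < e"
          by (simp add: pos_divide_less_eq mult.commute del: sum.cl_ivl_Suc of_nat_Suc)
        also have "\<bar>?s - real (Suc n) * ?\<mu>\<bar> / real (Suc n) = \<bar>(?s - real (Suc n) * ?\<mu>) / real (Suc n)\<bar>"
          by simp
        also have "(?s - real (Suc n) * ?\<mu>) / real (Suc n) = ?s / real (Suc n) - ?\<mu>"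
          by (simp add: diff_divide_distrib del: sum.cl_ivl_Suc of_nat_Suc)
        finally show ?case unfolding dist_real_def .
      qed
    qed
    then show ?case
      by (rule LIMSEQ_imp_Suc)
  qed
qed

lemma empirical_hs_converges:
  fixes P0 :: "'a::euclidean_space measure"
  assumes P0: "P0 \<in> borel_distributions" "smooth_dist P0" and X: "random_sample M P0 X"
  shows "AE w in M. hs_converges (\<lambda>n. empirical n (\<lambda>i. X i w)) P0"
proof -
  obtain \<F> where \<F>: "countable \<F>" "\<And>f. f \<in> \<F> \<Longrightarrow> continuous_on UNIV f \<and> range f \<subseteq> {0..1::real}"
    and det: "\<And>P. eventually (\<lambda>n. P n \<in> borel_distributions) sequentially \<Longrightarrow>
       (\<forall>f\<in>\<F>. (\<lambda>n. \<integral>x. f x \<partial>P n) \<longlonglongrightarrow> (\<integral>x. f x \<partial>P0)) \<Longrightarrow> hs_converges P P0"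
    using hs_convergence_determining[OF P0] by metis
  have meas: "f \<in> borel_measurable borel" if "f \<in> \<F>" for f
    using \<F>(2)[OF that] by (simp add: borel_measurable_continuous_onI)
  have "AE w in M. \<forall>f\<in>\<F>. (\<lambda>n. (\<Sum>i=1..n. f (X i w)) / real n) \<longlonglongrightarrow> (\<integral>x. f x \<partial>P0)"
    using \<F>(2) meas by (intro AE_ball_countable[THEN iffD2] \<F>(1) ballI
        random_sample_strong_law[OF X]) auto
  then show ?thesis
  proof eventually_elim
    case (elim w)
    show ?case
    proof (rule det)
      show "eventually (\<lambda>n. empirical n (\<lambda>i. X i w) \<in> borel_distributions) sequentially"
        using eventually_ge_at_top[of 1]
        by eventually_elim (rule empirical_in_borel_distributions)
      show "\<forall>f\<in>\<F>. (\<lambda>n. \<integral>x. f x \<partial>empirical n (\<lambda>i. X i w)) \<longlonglongrightarrow> (\<integral>x. f x \<partial>P0)"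
        using elim meas by (simp add: integral_empirical)
    qed
  qed
qed

section \<open>Consistency of the scatter halfspace median matrix\<close>

theorem theorem6:
  fixes P0 :: "(real^'d) measure" and Sigma_hs :: "real^'d^'d"
  assumes "P0 \<in> borel_distributions"
    and "smooth_dist P0"
    and "is_singleton (loc_median_set P0)"
    and "scatter_median_set P0 = {Sigma_hs}"
  shows
    "(\<forall>P S.
        (\<forall>n. P n \<in> borel_distributions) \<longrightarrow>
        weakly_converges P P0 \<longrightarrow>
        (\<forall>n. S n \<in> scatter_median_set (P n)) \<longrightarrow>
        (\<forall>i j. (\<lambda>n. S n $ i $ j) \<longlonglongrightarrow> Sigma_hs $ i $ j)) \<and>
     (\<forall>(M::'w measure) X S.
        random_sample M P0 X \<longrightarrow>
        (\<forall>n\<ge>1. AE w in M. S n w \<in> scatter_median_set (empirical n (\<lambda>i. X i w))) \<longrightarrow>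
        (AE w in M. \<forall>i j. (\<lambda>n. S n w $ i $ j) \<longlonglongrightarrow> Sigma_hs $ i $ j))"
proof (intro conjI allI impI)
  fix P :: "nat \<Rightarrow> (real^'d) measure" and S :: "nat \<Rightarrow> real^'d^'d" and i j
  assume P: "\<forall>n. P n \<in> borel_distributions" "weakly_converges P P0"
    and S: "\<forall>n. S n \<in> scatter_median_set (P n)"
  have "S \<longlonglongrightarrow> Sigma_hs"
    using P S by (intro scatter_median_tendsto[OF assms, of P]
        weakly_converges_imp_hs_converges[OF assms(1,2)]) auto
  then show "(\<lambda>n. S n $ i $ j) \<longlonglongrightarrow> Sigma_hs $ i $ j"
    by (intro tendsto_vec_nth)
next
  fix M :: "'w measure" and X S
  assume X: "random_sample M P0 X"
    and S: "\<forall>n\<ge>1. AE w in M. S n w \<in> scatter_median_set (empirical n (\<lambda>i. X i w))"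
  have "AE w in M. \<forall>n\<in>{1..}. S n w \<in> scatter_median_set (empirical n (\<lambda>i. X i w))"
    using S by (intro AE_ball_countable[THEN iffD2]) auto
  with empirical_hs_converges[OF assms(1,2) X]
  show "AE w in M. \<forall>i j. (\<lambda>n. S n w $ i $ j) \<longlonglongrightarrow> Sigma_hs $ i $ j"
  proof eventually_elim
    case (elim w)
    have ev: "eventually (\<lambda>n::nat. 1 \<le> n) sequentially" by (rule eventually_ge_at_top)
    have "(\<lambda>n. S n w) \<longlonglongrightarrow> Sigma_hs"
    proof (rule scatter_median_tendsto[OF assms _ elim(1)])
      show "eventually (\<lambda>n. empirical n (\<lambda>i. X i w) \<in> borel_distributions) sequentially"
        using ev by eventually_elim (rule empirical_in_borel_distributions)
      show "eventually (\<lambda>n. S n w \<in> scatter_median_set (empirical n (\<lambda>i. X i w))) sequentially"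
        using ev by eventually_elim (use elim(2) in auto)
    qed
    then show ?case by (intro allI tendsto_vec_nth)
  qed
qed

end
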